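(* The space $Y\subset\mathbb R^3$ (defined in the context) has the following properties: (1) its (unbased) Spanier group is non-trivial; (2) its based Spanier group is trivial; (3) it is (based) semilocally simply connected; (4) it is not unbased semilocally simply connected; (5) it is homotopically Hausdorff; (6) it is not strongly homotopically Hausdorff; (7) it is homotopically path-Hausdorff.
   Context: The space $Y$. $Y\subset\mathbb R^3$ (with the subspace topology) is the union of three pieces: (i) the surface portion, a topologists' sine curve rotated about the $z$-axis, $\{(r\cos\varphi,r\sin\varphi,\sin(1/r)) : 0<r\le 1,\ \varphi\in[0,2\pi]\}$; (ii) the central axis $\{(0,0)\}\times[-1,1]$, to which the surface tends as $r\to 0$; (iii) a single arc $C$ embedded in $\mathbb R^3$, with one endpoint on the central axis and the other endpoint on the surface portion, which meets the union of the surface portion and the central axis only in its two endpoints. Let $X$ be a path-connected space and $x_0\in X$. Spanier groups. For an open covering $\mathcal U$ of $X$, $\pi(\mathcal U,x_0)$ is the subgroup of $\pi_1(X,x_0)$ of all classes represented by products $\prod_{j=1}^n u_j v_j u_j^{-1}$, where the $u_j$ are arbitrary paths starting at $x_0$ and each $v_j$ is a loop, based at the endpoint of $u_j$, inside one of the sets of $\mathcal U$. The (unbased) Spanier group of $X$ is $\bigcap_{\mathcal U}\pi(\mathcal U,x_0)$ over all open coverings $\mathcal U$. An open covering of $X$ by pointed sets is a family $\mathcal V=\{(U_i,x_i)\mid i\in I\}$ with $U_i$ open, $x_i\in U_i$ and $\{x_i\mid i\in I\}=X$; $\pi^*(\mathcal V,x_0)$ is the subgroup of $\pi_1(X,x_0)$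 of all classes represented by products $\prod_{j=1}^n u_j v_j u_j^{-1}$, where each $u_j$ is a path from $x_0$ to some $x_i$ and $v_j$ is a loop based at $x_i$ inside the corresponding $U_i$. The based Spanier group of $X$ is $\bigcap_{\mathcal V}\pi^*(\mathcal V,x_0)$ over all open coverings by pointed sets. Triviality of these groups does not depend on $x_0$. Semilocal simple connectivity. $X$ is (based) semilocally simply connected if every $x\in X$ has a neighbourhood $U$ such that $\pi_1(U,x)\to\pi_1(X,x)$ is trivial; it is unbased semilocally simply connected if every $x\in X$ has a neighbourhood $U$ such that every loop in $U$ is null-homotopic in $X$. Homotopic Hausdorffness. $X$ is (weakly) homotopically Hausdorff if for every $x\in X$ and every non-trivial $\alpha\in\pi_1(X,x)$ there is a neighbourhood $U$ of $x$ such that no loop in $U$ is homotopic in $X$ to $\alpha$ rel. $x$. $X$ is strongly homotopically Hausdorff if for every $x\in X$ and every essential closed curve $\gamma$ in $X$ there is a neighbourhood of $x$ that contains no closed curve freely homotopic in $X$ to $\gamma$. $X$ is homotopically path-Hausdorff if for any two paths $w,v:[0,1]\to X$ with $w(0)=v(0)$ and $w(1)=v(1)$ that are not homotopic relative to the endpoints, there exist $0=t_0<t_1<\dots<t_k=1$ and open sets $U_1,\dots,U_k$ with $w([t_{i-1},t_i])\subseteq U_i$ for $1\le i\le k$ such that for any paths $w_i:[t_{i-1},t_i]\to U_i$ with $w_i(t_{i-1})=w(t_{i-1})$ and $w_i(t_i)=w(t_i)$, the concatenation $w_1*w_2*\cdots*w_k$ is not homotopic to $v$ relative to the endpoints. 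*)

theory Defs
  imports "HOL-Analysis.Analysis" "HOL-Algebra.Group"
begin

text \<open>A space is a subset \<open>X\<close> of the ambient type, carrying the subspace topology. Paths are
  functions on \<open>real\<close> of which only the restriction to \<open>{0..1}\<close> matters.\<close>

section \<open>The fundamental group\<close>

definition loops_at :: "'a::real_normed_vector set \<Rightarrow> 'a \<Rightarrow> (real \<Rightarrow> 'a) set" where
  "loops_at X x = {p. path p \<and> path_image p \<subseteq> X \<and> pathstart p = x \<and> pathfinish p = x}"

definition path_class :: "'a::real_normed_vector set \<Rightarrow> (real \<Rightarrow> 'a) \<Rightarrow> (real \<Rightarrow> 'a) set" where
  "path_class X p = {q. homotopic_paths X p q}"

definition fund_group :: "'a::real_normed_vector set \<Rightarrow> 'a \<Rightarrow> (real \<Rightarrow> 'a) set monoid" where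
  "fund_group X x =
     \<lparr>carrier = path_class X ` loops_at X x,
      mult = (\<lambda>\<alpha> \<beta>. \<Union>p\<in>\<alpha>. \<Union>q\<in>\<beta>. path_class X (p +++ q)),
      one = path_class X (linepath x x)\<rparr>"

text \<open>The map on fundamental groups induced by an inclusion of a subspace in \<open>X\<close>.\<close>

definition incl_hom :: "'a::real_normed_vector set \<Rightarrow> (real \<Rightarrow> 'a) set \<Rightarrow> (real \<Rightarrow> 'a) set" where
  "incl_hom X \<alpha> = (\<Union>p\<in>\<alpha>. path_class X p)"

lemma path_class_eq:
  assumes "homotopic_paths X p q"
  shows "path_class X p = path_class X q"
  unfolding path_class_def
  using homotopic_paths_trans[OF assms] homotopic_paths_trans[OF homotopic_paths_sym[OF assms]]
  by blast

lemma path_class_eq_iff: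
  assumes "path p" "path_image p \<subseteq> X"
  shows "path_class X p = path_class X q \<longleftrightarrow> homotopic_paths X p q"
proof
  assume eq: "path_class X p = path_class X q"
  have "p \<in> path_class X p" using assms by (simp add: path_class_def)
  with eq have "p \<in> path_class X q" by simp
  then show "homotopic_paths X p q" by (simp add: path_class_def homotopic_paths_sym)
qed (rule path_class_eq)

lemma carrier_fund_group: "carrier (fund_group X x) = path_class X ` loops_at X x"
  and one_fund_group: "\<one>\<^bsub>fund_group X x\<^esub> = path_class X (linepath x x)"
  by (simp_all add: fund_group_def)

lemma mult_fund_group:
  assumes "p \<in> loops_at X x" "q \<in> loops_at X x"
  shows "path_class X p \<otimes>\<^bsub>fund_group X x\<^esub> path_class X q = path_class X (p +++ q)"
proof -
  have eq: "path_class X (p' +++ q') = path_class X (p +++ q)"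
    if "p' \<in> path_class X p" "q' \<in> path_class X q" for p' q'
  proof -
    have "homotopic_paths X (p +++ q) (p' +++ q')"
      using that assms by (intro homotopic_paths_join) (auto simp: path_class_def loops_at_def)
    then show ?thesis by (rule path_class_eq[symmetric])
  qed
  have "p \<in> path_class X p" "q \<in> path_class X q"
    using assms by (auto simp: path_class_def loops_at_def)
  then have "(\<Union>p'\<in>path_class X p. \<Union>q'\<in>path_class X q. path_class X (p' +++ q'))
             = path_class X (p +++ q)"
    using eq by blast
  then show ?thesis by (simp add: fund_group_def)
qed

lemma incl_hom_path_class:
  assumes "path p" "path_image p \<subseteq> U" "U \<subseteq> X"
  shows "incl_hom X (path_class U p) = path_class X p"
proof -
  have "path_class X q = path_class X p" if "q \<in> path_class U p" for q
  proof -
    have "homotopic_paths X p q"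
      using that assms(3) by (auto simp: path_class_def intro: homotopic_paths_subset)
    then show ?thesis by (rule path_class_eq[symmetric])
  qed
  moreover have "p \<in> path_class U p" using assms by (simp add: path_class_def)
  ultimately show ?thesis unfolding incl_hom_def by blast
qed

lemma join_in_loops_at: "p \<in> loops_at X x \<Longrightarrow> q \<in> loops_at X x \<Longrightarrow> p +++ q \<in> loops_at X x"
  by (auto simp: loops_at_def path_image_join)

lemma reversepath_in_loops_at: "p \<in> loops_at X x \<Longrightarrow> reversepath p \<in> loops_at X x"
  by (auto simp: loops_at_def)

lemma linepath_in_loops_at: "x \<in> X \<Longrightarrow> linepath x x \<in> loops_at X x"
  by (auto simp: loops_at_def)

lemma group_fund_group:
  assumes "x \<in> X"
  shows "group (fund_group X x)"
proof (rule groupI)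
  let ?G = "fund_group X x"
  show "a \<otimes>\<^bsub>?G\<^esub> b \<in> carrier ?G" if "a \<in> carrier ?G" "b \<in> carrier ?G" for a b
    using that by (auto simp: carrier_fund_group mult_fund_group join_in_loops_at)
  show "\<one>\<^bsub>?G\<^esub> \<in> carrier ?G"
    using assms by (simp add: carrier_fund_group one_fund_group linepath_in_loops_at)
  show "a \<otimes>\<^bsub>?G\<^esub> b \<otimes>\<^bsub>?G\<^esub> c = a \<otimes>\<^bsub>?G\<^esub> (b \<otimes>\<^bsub>?G\<^esub> c)"
    if abc: "a \<in> carrier ?G" "b \<in> carrier ?G" "c \<in> carrier ?G" for a b c
  proof -
    obtain p q r where *: "p \<in> loops_at X x" "q \<in> loops_at X x" "r \<in> loops_at X x"
      and [simp]: "a = path_class X p" "b = path_class X q" "c = path_class X r"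
      using abc by (auto simp: carrier_fund_group)
    have "homotopic_paths X (p +++ (q +++ r)) ((p +++ q) +++ r)"
      using * by (intro homotopic_paths_assoc) (auto simp: loops_at_def)
    with * show ?thesis
      by (simp add: mult_fund_group join_in_loops_at path_class_eq)
  qed
  show "\<one>\<^bsub>?G\<^esub> \<otimes>\<^bsub>?G\<^esub> a = a" if a: "a \<in> carrier ?G" for a
  proof -
    obtain p where p: "p \<in> loops_at X x" "a = path_class X p"
      using a by (auto simp: carrier_fund_group)
    then have "homotopic_paths X (linepath x x +++ p) p"
      by (intro homotopic_paths_lid') (auto simp: loops_at_def)
    with p assms show ?thesis
      by (simp add: one_fund_group mult_fund_group linepath_in_loops_at path_class_eq)
  qed
  show "\<exists>b\<in>carrier ?G. b \<otimes>\<^bsub>?G\<^esub> a = \<one>\<^bsub>?G\<^esub>" if a: "a \<in> carrier ?G" for a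
  proof -
    obtain p where p: "p \<in> loops_at X x" "a = path_class X p"
      using a by (auto simp: carrier_fund_group)
    have "homotopic_paths X (reversepath p +++ p) (linepath x x)"
      using homotopic_paths_linv[of p X] p by (auto simp: loops_at_def)
    with p show ?thesis
      by (intro bexI[of _ "path_class X (reversepath p)"])
         (simp_all add: carrier_fund_group one_fund_group mult_fund_group
           reversepath_in_loops_at path_class_eq)
  qed
qed

section \<open>Spanier groups\<close>

text \<open>For \<open>uvs = [(u\<^sub>1, v\<^sub>1), \<dots>, (u\<^sub>n, v\<^sub>n)]\<close> this is the product of the
  loops \<open>u\<^sub>j v\<^sub>j u\<^sub>j\<^sup>-\<^sup>1\<close>; the empty product is the constant loop.\<close>

fun conj_product ::
  "'a::real_normed_vector \<Rightarrow> ((real \<Rightarrow> 'a) \<times> (real \<Rightarrow> 'a)) list \<Rightarrow> real \<Rightarrow> 'a" where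
  "conj_product x [] = linepath x x"
| "conj_product x ((u, v) # uvs) = (u +++ v +++ reversepath u) +++ conj_product x uvs"

definition conj_product_classes ::
  "'a::real_normed_vector set \<Rightarrow> 'a \<Rightarrow> ((real \<Rightarrow> 'a) \<times> (real \<Rightarrow> 'a)) set \<Rightarrow> (real \<Rightarrow> 'a) set set"
  where "conj_product_classes X x R = {path_class X (conj_product x uvs) |uvs. set uvs \<subseteq> R}"

definition open_covering :: "'a::real_normed_vector set \<Rightarrow> 'a set set \<Rightarrow> bool" where
  "open_covering X \<U> \<longleftrightarrow> (\<forall>U\<in>\<U>. openin (top_of_set X) U) \<and> \<Union>\<U> = X"

definition spanier_subgroup ::
  "'a::real_normed_vector set \<Rightarrow> 'a \<Rightarrow> 'a set set \<Rightarrow> (real \<Rightarrow> 'a) set set" where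
  "spanier_subgroup X x \<U> = conj_product_classes X x
     {(u, v). path u \<and> path_image u \<subseteq> X \<and> pathstart u = x
        \<and> (\<exists>U\<in>\<U>. v \<in> loops_at U (pathfinish u))}"

definition unbased_spanier_group ::
  "'a::real_normed_vector set \<Rightarrow> 'a \<Rightarrow> (real \<Rightarrow> 'a) set set" where
  "unbased_spanier_group X x = (\<Inter>\<U>\<in>{\<U>. open_covering X \<U>}. spanier_subgroup X x \<U>)"

definition pointed_open_covering ::
  "'a::real_normed_vector set \<Rightarrow> ('a set \<times> 'a) set \<Rightarrow> bool" where
  "pointed_open_covering X \<V> \<longleftrightarrow>
     (\<forall>(U, y)\<in>\<V>. openin (top_of_set X) U \<and> y \<in> U) \<and> snd ` \<V> = X"

definition pointed_spanier_subgroup ::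
  "'a::real_normed_vector set \<Rightarrow> 'a \<Rightarrow> ('a set \<times> 'a) set \<Rightarrow> (real \<Rightarrow> 'a) set set" where
  "pointed_spanier_subgroup X x \<V> = conj_product_classes X x
     {(u, v). path u \<and> path_image u \<subseteq> X \<and> pathstart u = x
        \<and> (\<exists>(U, y)\<in>\<V>. pathfinish u = y \<and> v \<in> loops_at U y)}"

definition based_spanier_group ::
  "'a::real_normed_vector set \<Rightarrow> 'a \<Rightarrow> (real \<Rightarrow> 'a) set set" where
  "based_spanier_group X x =
     (\<Inter>\<V>\<in>{\<V>. pointed_open_covering X \<V>}. pointed_spanier_subgroup X x \<V>)"

lemma conj_product_in_loops_at:
  assumes "x \<in> X"
    and "\<And>u v. (u, v) \<in> set uvs \<Longrightarrow>
           path u \<and> path_image u \<subseteq> X \<and> pathstart u = x \<and> v \<in> loops_at X (pathfinish u)"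
  shows "conj_product x uvs \<in> loops_at X x"
  using assms(2)
proof (induction uvs)
  case Nil
  show ?case unfolding conj_product.simps by (rule linepath_in_loops_at[OF assms(1)])
next
  case (Cons a uvs)
  obtain u v where a: "a = (u, v)" by force
  have "u +++ v +++ reversepath u \<in> loops_at X x"
    using Cons.prems[of u v] a by (auto simp: loops_at_def path_image_join)
  moreover have "conj_product x uvs \<in> loops_at X x"
    using Cons.prems by (intro Cons.IH) (meson list.set_intros(2))
  ultimately show ?case by (simp add: a join_in_loops_at)
qed

lemma subgroup_conj_product_classes:
  assumes x: "x \<in> X"
    and R: "\<And>u v. (u, v) \<in> R \<Longrightarrow>
           path u \<and> path_image u \<subseteq> X \<and> pathstart u = x \<and> v \<in> loops_at X (pathfinish u)"
    and rev: "\<And>u v. (u, v) \<in> R \<Longrightarrow> (u, reversepath v) \<in> R"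
  shows "subgroup (conj_product_classes X x R) (fund_group X x)"
proof -
  let ?G = "fund_group X x" and ?H = "conj_product_classes X x R"
  interpret group ?G by (rule group_fund_group[OF x])
  let ?c = "\<lambda>uvs. path_class X (conj_product x uvs)"
  have L: "conj_product x uvs \<in> loops_at X x" if "set uvs \<subseteq> R" for uvs
    using that by (intro conj_product_in_loops_at[OF x]) (auto dest!: R)
  have C: "?c uvs \<in> carrier ?G" if "set uvs \<subseteq> R" for uvs
    using L[OF that] by (simp add: carrier_fund_group)
  have K: "u +++ v +++ reversepath u \<in> loops_at X x" if "(u, v) \<in> R" for u v
    using R[OF that] by (auto simp: loops_at_def path_image_join)
  have cons: "?c ((u, v) # uvs) = path_class X (u +++ v +++ reversepath u) \<otimes>\<^bsub>?G\<^esub> ?c uvs"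
    if "(u, v) \<in> R" "set uvs \<subseteq> R" for u v uvs
    using that by (simp add: mult_fund_group L K)
  have one: "?c [] = \<one>\<^bsub>?G\<^esub>" by (simp add: one_fund_group)
  have app: "?c (us @ vs) = ?c us \<otimes>\<^bsub>?G\<^esub> ?c vs" if "set us \<subseteq> R" "set vs \<subseteq> R" for us vs
    using that(1)
  proof (induction us)
    case Nil
    then show ?case using C[OF that(2)] one by (simp del: conj_product.simps)
  next
    case (Cons a us)
    obtain u v where a: "a = (u, v)" by force
    have "path_class X (u +++ v +++ reversepath u) \<in> carrier ?G"
      using K Cons.prems a by (auto simp: carrier_fund_group)
    then show ?case
      using Cons that(2) C[of us] C[of vs] cons[of u v us] cons[of u v "us @ vs"]
      by (simp add: a m_assoc)
  qed
  have inv1: "inv\<^bsub>?G\<^esub> (path_class X (u +++ v +++ reversepath u))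
              = path_class X (u +++ reversepath v +++ reversepath u)" if uv: "(u, v) \<in> R" for u v
  proof -
    let ?p = "u +++ v +++ reversepath u" and ?q = "u +++ reversepath v +++ reversepath u"
    have "homotopic_paths X (reversepath ?p) ?q"
      using R[OF uv]
      by (simp add: reversepath_joinpaths loops_at_def)
         (intro homotopic_paths_sym[OF homotopic_paths_assoc], auto)
    then have q: "path_class X ?q = path_class X (reversepath ?p)"
      by (rule path_class_eq[symmetric])
    have "homotopic_paths X (reversepath ?p +++ ?p) (linepath x x)"
      using homotopic_paths_linv[of ?p X] K[OF uv] by (auto simp: loops_at_def)
    then have "path_class X (reversepath ?p) \<otimes>\<^bsub>?G\<^esub> path_class X ?p = \<one>\<^bsub>?G\<^esub>"
      using K[OF uv]
      by (simp add: mult_fund_group reversepath_in_loops_at one_fund_group path_class_eq)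
    then show ?thesis
      unfolding q using K[OF uv]
      by (intro inv_equality) (auto simp: carrier_fund_group intro: reversepath_in_loops_at)
  qed
  show ?thesis
  proof (rule subgroupI)
    show "?H \<subseteq> carrier ?G" using C by (auto simp: conj_product_classes_def)
    have "?c [] \<in> ?H" unfolding conj_product_classes_def by (intro CollectI exI[of _ "[]"]) simp
    then show "?H \<noteq> {}" by blast
    show "inv\<^bsub>?G\<^esub> a \<in> ?H" if a: "a \<in> ?H" for a
    proof -
      obtain us where us: "set us \<subseteq> R" "a = ?c us"
        using a unfolding conj_product_classes_def by blast
      have "\<exists>vs. set vs \<subseteq> R \<and> inv\<^bsub>?G\<^esub> (?c us) = ?c vs" using us(1)
      proof (induction us)
        case Nil
        then show ?case by (intro exI[of _ "[]"]) (simp add: one del: conj_product.simps)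
      next
        case (Cons b us)
        obtain u v where b: "b = (u, v)" by force
        from Cons obtain vs where vs: "set vs \<subseteq> R" "inv\<^bsub>?G\<^esub> (?c us) = ?c vs" by auto
        have uv: "(u, v) \<in> R" "(u, reversepath v) \<in> R" using Cons.prems b rev by auto
        have pc: "path_class X (u +++ v +++ reversepath u) \<in> carrier ?G"
          and pc': "path_class X (u +++ reversepath v +++ reversepath u) \<in> carrier ?G"
          using K[OF uv(1)] K[OF uv(2)] by (simp_all add: carrier_fund_group)
        have "?c [(u, reversepath v)] = path_class X (u +++ reversepath v +++ reversepath u)"
          using cons[OF uv(2), of "[]"] pc' one by (simp del: conj_product.simps)
        then have "?c (vs @ [(u, reversepath v)]) = inv\<^bsub>?G\<^esub> (?c (b # us))"
          using app[of vs "[(u, reversepath v)]"] vs uv Cons.prems cons[OF uv(1), of us] pc C[of us]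
            inv1[OF uv(1)]
          by (simp add: b inv_mult_group del: conj_product.simps)
        then show ?case using vs uv by (intro exI[of _ "vs @ [(u, reversepath v)]"]) auto
      qed
      then show ?thesis using us by (auto simp: conj_product_classes_def)
    qed
    show "a \<otimes>\<^bsub>?G\<^esub> b \<in> ?H" if ab: "a \<in> ?H" "b \<in> ?H" for a b
    proof -
      obtain us vs where "set us \<subseteq> R" "a = ?c us" "set vs \<subseteq> R" "b = ?c vs"
        using ab unfolding conj_product_classes_def by blast
      then show ?thesis unfolding conj_product_classes_def
        by (intro CollectI exI[of _ "us @ vs"]) (simp add: app del: conj_product.simps)
    qed
  qed
qed

lemma loops_at_mono: "U \<subseteq> X \<Longrightarrow> loops_at U x \<subseteq> loops_at X x"
  by (auto simp: loops_at_def)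

lemma subgroup_spanier_subgroup:
  assumes "x \<in> X" "open_covering X \<U>"
  shows "subgroup (spanier_subgroup X x \<U>) (fund_group X x)"
proof -
  have "loops_at U y \<subseteq> loops_at X y" if "U \<in> \<U>" for U y
    using assms(2) that by (intro loops_at_mono) (auto simp: open_covering_def)
  then show ?thesis
    unfolding spanier_subgroup_def using assms(1)
    by (intro subgroup_conj_product_classes) (auto intro: reversepath_in_loops_at)
qed

lemma subgroup_pointed_spanier_subgroup:
  assumes "x \<in> X" "pointed_open_covering X \<V>"
  shows "subgroup (pointed_spanier_subgroup X x \<V>) (fund_group X x)"
proof -
  have "loops_at U y \<subseteq> loops_at X y" if "(U, y) \<in> \<V>" for U y
  proof -
    have "openin (top_of_set X) U"
      using assms(2) that by (auto simp: pointed_open_covering_def)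
    then show ?thesis by (intro loops_at_mono openin_imp_subset)
  qed
  then show ?thesis
    unfolding pointed_spanier_subgroup_def using assms(1)
    by (intro subgroup_conj_product_classes) (auto intro: reversepath_in_loops_at)
qed

section \<open>Local and separation properties\<close>

definition nbhd_in :: "'a::real_normed_vector set \<Rightarrow> 'a \<Rightarrow> 'a set \<Rightarrow> bool" where
  "nbhd_in X x U \<longleftrightarrow> U \<subseteq> X \<and> (\<exists>W. openin (top_of_set X) W \<and> x \<in> W \<and> W \<subseteq> U)"

definition closed_curve_in :: "'a::real_normed_vector set \<Rightarrow> (real \<Rightarrow> 'a) \<Rightarrow> bool" where
  "closed_curve_in X \<gamma> \<longleftrightarrow> path \<gamma> \<and> path_image \<gamma> \<subseteq> X \<and> pathfinish \<gamma> = pathstart \<gamma>"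

definition null_homotopic_in :: "'a::real_normed_vector set \<Rightarrow> (real \<Rightarrow> 'a) \<Rightarrow> bool" where
  "null_homotopic_in X \<gamma> \<longleftrightarrow> (\<exists>a. homotopic_loops X \<gamma> (linepath a a))"

definition based_semilocally_simply_connected :: "'a::real_normed_vector set \<Rightarrow> bool" where
  "based_semilocally_simply_connected X \<longleftrightarrow>
     (\<forall>x\<in>X. \<exists>U. nbhd_in X x U \<and>
        (\<forall>\<alpha>\<in>carrier (fund_group U x). incl_hom X \<alpha> = \<one>\<^bsub>fund_group X x\<^esub>))"

definition unbased_semilocally_simply_connected :: "'a::real_normed_vector set \<Rightarrow> bool" where
  "unbased_semilocally_simply_connected X \<longleftrightarrow>
     (\<forall>x\<in>X. \<exists>U. nbhd_in X x U \<and> (\<forall>\<gamma>. closed_curve_in U \<gamma> \<longrightarrow> null_homotopic_in X \<gamma>))"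

definition homotopically_Hausdorff :: "'a::real_normed_vector set \<Rightarrow> bool" where
  "homotopically_Hausdorff X \<longleftrightarrow>
     (\<forall>x\<in>X. \<forall>\<alpha>\<in>carrier (fund_group X x). \<alpha> \<noteq> \<one>\<^bsub>fund_group X x\<^esub> \<longrightarrow>
        (\<exists>U. nbhd_in X x U \<and> (\<forall>p\<in>loops_at U x. path_class X p \<noteq> \<alpha>)))"

definition strongly_homotopically_Hausdorff :: "'a::real_normed_vector set \<Rightarrow> bool" where
  "strongly_homotopically_Hausdorff X \<longleftrightarrow>
     (\<forall>x\<in>X. \<forall>\<gamma>. closed_curve_in X \<gamma> \<and> \<not> null_homotopic_in X \<gamma> \<longrightarrow>
        (\<exists>U. nbhd_in X x U \<and> (\<forall>\<delta>. closed_curve_in U \<delta> \<longrightarrow> \<not> homotopic_loops X \<delta> \<gamma>)))"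

text \<open>The concatenation of paths \<open>w i\<close> parametrized on \<open>{t (i - 1)..t i}\<close>: at \<open>s\<close> it has the
  value of the first piece whose interval contains \<open>s\<close>. When neighbouring pieces agree at the
  common endpoints, as below, this choice does not matter.\<close>

definition concat_pieces :: "(nat \<Rightarrow> real) \<Rightarrow> (nat \<Rightarrow> real \<Rightarrow> 'a) \<Rightarrow> real \<Rightarrow> 'a" where
  "concat_pieces t w s = w (LEAST i. 1 \<le> i \<and> s \<le> t i) s"

definition homotopically_path_Hausdorff :: "'a::real_normed_vector set \<Rightarrow> bool" where
  "homotopically_path_Hausdorff X \<longleftrightarrow>
     (\<forall>w v. path w \<and> path_image w \<subseteq> X \<and> path v \<and> path_image v \<subseteq> X \<and>
        pathstart w = pathstart v \<and> pathfinish w = pathfinish v \<and> \<not> homotopic_paths X w v \<longrightarrow>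
        (\<exists>(k::nat) (t::nat \<Rightarrow> real) U.
           t 0 = 0 \<and> t k = 1 \<and> (\<forall>i\<in>{1..k}. t (i - 1) < t i) \<and>
           (\<forall>i\<in>{1..k}. openin (top_of_set X) (U i) \<and> w ` {t (i - 1)..t i} \<subseteq> U i) \<and>
           (\<forall>w'. (\<forall>i\<in>{1..k}. continuous_on {t (i - 1)..t i} (w' i) \<and>
                    w' i ` {t (i - 1)..t i} \<subseteq> U i \<and>
                    w' i (t (i - 1)) = w (t (i - 1)) \<and> w' i (t i) = w (t i)) \<longrightarrow>
                 \<not> homotopic_paths X (concat_pieces t w') v)))"

lemma concat_pieces_eq:
  assumes mono: "\<forall>i\<in>{1..k}. t (i - 1) < t i"
    and agree: "\<forall>i\<in>{1..k}. w' i (t (i - 1)) = w (t (i - 1)) \<and> w' i (t i) = w (t i)"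
    and i: "i \<in> {1..k}" and s: "s \<in> {t (i - 1)..t i}"
  shows "concat_pieces t w' s = w' i s"
proof -
  define j where "j = (LEAST i. 1 \<le> i \<and> s \<le> t i)"
  have j: "1 \<le> j" "s \<le> t j" "j \<le> i"
    using i s LeastI[of "\<lambda>i. 1 \<le> i \<and> s \<le> t i" i] Least_le[of "\<lambda>i. 1 \<le> i \<and> s \<le> t i" i]
    by (auto simp: j_def)
  have less: "t a < t b" if "a < b" "b \<le> k" for a b
    using that
  proof (induction b)
    case (Suc b)
    have "t b < t (Suc b)" using mono[rule_format, of "Suc b"] Suc.prems by simp
    with Suc show ?case by (cases "a = b") auto
  qed simp
  consider "j = i" | "j = i - 1" "i \<ge> 2" | "j < i - 1" using j by linarith
  then have "w' j s = w' i s"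
  proof cases
    case 2
    then have "s = t j" using j s by auto
    then show ?thesis using 2 agree[rule_format, of i] agree[rule_format, of j] i j by auto
  next
    case 3
    then have "t j < t (i - 1)" using i by (intro less) auto
    then show ?thesis using j s by auto
  qed simp
  then show ?thesis by (simp add: concat_pieces_def j_def)
qed

section \<open>The space \<open>Y\<close>\<close>

definition surface_portion :: "(real^3) set" where
  "surface_portion =
     {vector [r * cos \<phi>, r * sin \<phi>, sin (1 / r)] |r \<phi>. 0 < r \<and> r \<le> 1 \<and> \<phi> \<in> {0..2 * pi}}"

definition central_axis :: "(real^3) set" where
  "central_axis = {vector [0, 0, z] |z. z \<in> {-1..1}}"

definition connecting_arc :: "(real^3) set \<Rightarrow> bool" where
  "connecting_arc C \<longleftrightarrow>
     (\<exists>g. arc g \<and> path_image g = C \<and> pathstart g \<in> central_axis \<and> pathfinish g \<in> surface_portion \<and>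
          C \<inter> (surface_portion \<union> central_axis) = {pathstart g, pathfinish g})"

definition space_Y :: "(real^3) set \<Rightarrow> (real^3) set" where
  "space_Y C = surface_portion \<union> central_axis \<union> C"

lemma connecting_arc_exists: "\<exists>C. connecting_arc C"
proof -
  define a :: real where "a = 2 / pi"
  define g :: "real \<Rightarrow> real^3" where "g = (\<lambda>t. vector [a * t, 0, 1 + t * (1 - t)])"
  have a: "0 < a" "a < 1" using pi_gt3 by (auto simp: a_def field_simps)
  have "continuous_on {0..1} (\<lambda>t. g t $ i)" for i
  proof -
    have "continuous_on {0..1} (\<lambda>t. g t $ 1)" "continuous_on {0..1} (\<lambda>t. g t $ 2)"
      "continuous_on {0..1} (\<lambda>t. g t $ 3)"
      unfolding g_def vector_3 by (intro continuous_intros)+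
    then show ?thesis using exhaust_3[of i] by blast
  qed
  then have "continuous_on {0..1} (\<lambda>t. \<chi> i. g t $ i)"
    by (intro continuous_on_vec_lambda)
  then have "path g" by (simp add: path_def)
  moreover have "inj_on g {0..1}"
  proof (rule inj_onI)
    fix s t assume "g s = g t"
    then have "g s $ 1 = g t $ 1" by simp
    then show "s = t" using a by (simp add: g_def)
  qed
  ultimately have arc: "arc g" by (simp add: arc_def)
  have g0: "pathstart g = vector [0, 0, 1]" and g1: "pathfinish g = vector [a, 0, 1]"
    by (simp_all add: g_def pathstart_def pathfinish_def)
  have start: "pathstart g \<in> central_axis" unfolding g0 central_axis_def by force
  have fin: "pathfinish g \<in> surface_portion"
    unfolding g1 surface_portion_def using a
    by (intro CollectI exI[of _ a] exI[of _ 0]) (simp add: a_def)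
  have "g t \<in> {pathstart g, pathfinish g}"
    if t: "t \<in> {0..1}" and mem: "g t \<in> surface_portion \<union> central_axis" for t
  proof -
    have "g t $ 3 \<le> 1"
      using mem by (auto simp: surface_portion_def central_axis_def)
    then have "t * (1 - t) \<le> 0" by (simp add: g_def)
    moreover have "t * (1 - t) \<ge> 0" using t by simp
    ultimately have "t = 0 \<or> t = 1" by (metis antisym mult_eq_0_iff right_minus_eq)
    then show ?thesis by (auto simp: pathstart_def pathfinish_def)
  qed
  then have "path_image g \<inter> (surface_portion \<union> central_axis) \<subseteq> {pathstart g, pathfinish g}"
    unfolding path_image_def by blast
  then have "path_image g \<inter> (surface_portion \<union> central_axis) = {pathstart g, pathfinish g}"
    using start fin pathstart_in_path_image[of g] pathfinish_in_path_image[of g] by blast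
  with arc start fin show ?thesis unfolding connecting_arc_def by blast
qed

end

theory Submission
  imports Defs "HOL-Complex_Analysis.Riemann_Mapping"
begin

text \<open>The plane projection of the surface portion is the punctured unit disc, so the surface is an
  annulus whose generator is a circle around the axis. The axis together with the arc is a contractible
  set, called the spine below, which meets the surface only in the end point of the arc, the gate.

  The topologist's sine oscillation makes the spine invisible from the surface side: a path that
  passes from the spine to the surface other than through the gate would approach the axis along the
  surface, and its height would oscillate between \<open>-1\<close> and \<open>1\<close>
  (\<open>path_spine_to_surface_meets_gate\<close>). Hence the map \<open>collapse\<close>, which projects the surface to the
  punctured disc and sends the whole spine to the projection of the gate, is continuous along all paths
  and homotopies, although it is not continuous on the space itself. Contracting the spine to the gate
  shows conversely that nothing is lost: two paths with the same ends are homotopic if and only if their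
  collapsed images have the same winding number around \<open>0\<close>
  (\<open>homotopic_paths_imp_winding_eq\<close>, \<open>winding_eq_imp_homotopic_paths\<close>). In particular the fundamental
  group embeds into the integers.

  All seven properties come from one contrast. A short path that passes through a given point \<open>x\<close> has
  its collapsed image in a disc that misses \<open>0\<close> (\<open>collapse_near_point\<close>): a point of the axis has no
  path in a small neighbourhood to the surface, and a point of the surface is at positive distance from
  the axis. This gives the three based properties, and, after cutting a path into pieces that
  each have the centre of a good neighbourhood as an end, the path-Hausdorff property. On the other
  hand every neighbourhood of a point of the axis contains full circles of the surface
  (\<open>small_circle_near_origin\<close>), which wind once around \<open>0\<close>, and all of these are freely homotopic to
  each other. This defeats the unbased properties.\<close>

section \<open>The surface as a graph over the punctured disc\<close>

definition shadow :: "real^3 \<Rightarrow> complex" where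
  "shadow p = Complex (p $ 1) (p $ 2)"

definition graph_pt :: "complex \<Rightarrow> real^3" where
  "graph_pt w = vector [Re w, Im w, sin (1 / cmod w)]"

definition punctured_disc :: "complex set" where
  "punctured_disc = {w. w \<noteq> 0 \<and> cmod w \<le> 1}"

lemma shadow_graph_pt [simp]: "shadow (graph_pt w) = w"
  by (simp add: shadow_def graph_pt_def)

lemma surface_portion_eq_graph: "surface_portion = graph_pt ` punctured_disc"
proof
  show "surface_portion \<subseteq> graph_pt ` punctured_disc"
  proof
    fix p assume "p \<in> surface_portion"
    then obtain r \<phi> where r: "0 < r" "r \<le> 1"
      and p: "p = vector [r * cos \<phi>, r * sin \<phi>, sin (1 / r)]"
      by (auto simp: surface_portion_def)
    have "p = graph_pt (rcis r \<phi>)" "rcis r \<phi> \<in> punctured_disc"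
      using r by (auto simp: p graph_pt_def punctured_disc_def)
    then show "p \<in> graph_pt ` punctured_disc" by blast
  qed
next
  show "graph_pt ` punctured_disc \<subseteq> surface_portion"
  proof
    fix p assume "p \<in> graph_pt ` punctured_disc"
    then obtain w where w: "w \<in> punctured_disc" "p = graph_pt w" by blast
    have "w = rcis (cmod w) (Arg2pi w)"
      using complex_norm_eq_1_exp Arg2pi_eq[of w] by (simp add: rcis_def cis_conv_exp)
    then have "Re w = cmod w * cos (Arg2pi w)" "Im w = cmod w * sin (Arg2pi w)"
      by (metis Re_rcis, metis Im_rcis)
    then show "p \<in> surface_portion"
      unfolding surface_portion_def using w Arg2pi[of w]
      by (intro CollectI exI[of _ "cmod w"] exI[of _ "Arg2pi w"])
         (auto simp: graph_pt_def punctured_disc_def)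
  qed
qed

lemma graph_pt_shadow [simp]: "p \<in> surface_portion \<Longrightarrow> graph_pt (shadow p) = p"
  by (auto simp: surface_portion_eq_graph)

lemma shadow_surface: "p \<in> surface_portion \<Longrightarrow> shadow p \<in> punctured_disc"
  by (auto simp: surface_portion_eq_graph)

lemma surface_height: "p \<in> surface_portion \<Longrightarrow> p $ 3 = sin (1 / cmod (shadow p))"
  by (auto simp: surface_portion_eq_graph) (simp add: graph_pt_def)

lemma shadow_axis: "p \<in> central_axis \<Longrightarrow> shadow p = 0"
  by (auto simp: central_axis_def shadow_def complex_eq_iff)

lemma surface_axis_disjoint: "surface_portion \<inter> central_axis = {}"
  using shadow_surface shadow_axis by (fastforce simp: punctured_disc_def)

lemma dist_shadow_le: "dist (shadow p) (shadow q) \<le> dist p q"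
proof -
  have "(cmod (shadow p - shadow q))\<^sup>2 \<le> (norm (p - q))\<^sup>2"
    unfolding shadow_def cmod_power2 power2_norm_eq_inner
    by (simp add: inner_vec_def sum_3 power2_eq_square)
  then show ?thesis
    by (simp add: dist_norm)
qed

lemma continuous_on_shadow [continuous_intros]: "continuous_on T shadow"
  unfolding continuous_on_iff by (meson dist_shadow_le le_less_trans)

lemma continuous_on_graph_pt:
  assumes "0 \<notin> T"
  shows "continuous_on T graph_pt"
proof -
  have "continuous_on T (\<lambda>w. graph_pt w $ 1)" "continuous_on T (\<lambda>w. graph_pt w $ 2)"
    unfolding graph_pt_def vector_3 by (intro continuous_intros)+
  moreover have "continuous_on T (\<lambda>w. graph_pt w $ 3)"
    unfolding graph_pt_def vector_3 using assms by (intro continuous_intros) auto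
  ultimately have "continuous_on T (\<lambda>w. graph_pt w $ i)" for i
    using exhaust_3[of i] by blast
  then have "continuous_on T (\<lambda>w. \<chi> i. graph_pt w $ i)"
    by (intro continuous_on_vec_lambda)
  then show ?thesis by simp
qed

text \<open>This is the oscillation of \<open>sin (1 / r)\<close>, used twice: it keeps paths on the surface away from the
  axis, and it yields essential circles near the origin.\<close>

lemma small_radius_of_height:
  fixes z e :: real
  assumes "\<bar>z\<bar> \<le> 1" "0 < e"
  obtains r where "0 < r" "r \<le> 1" "r < e" "sin (1 / r) = z"
proof -
  \<comment> \<open>The reciprocal of \<open>r\<close> is the arcsine of \<open>z\<close> shifted by \<open>n\<close> periods; the summand \<open>2\<close>
    makes the shift outweigh a negative arcsine, and \<open>1 / e\<close> makes \<open>r\<close> smaller than \<open>e\<close>.\<close>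
  obtain n :: nat where n: "2 + 1 / e < real n" using reals_Archimedean2 by blast
  define a where "a = arcsin z + 2 * pi * real n"
  have "arcsin z \<ge> - (pi / 2)" using assms arcsin_lbound[of z] by (simp add: abs_le_iff)
  moreover have "2 * pi * real n \<ge> pi * real n + 3 * real n"
    using pi_gt3 mult_right_mono[of 3 pi "real n"] by simp
  moreover have n2: "real n > 2" using n assms(2) by (smt (verit) divide_pos_pos)
  then have "pi * real n \<ge> pi * 1" by (intro mult_left_mono) auto
  ultimately have a: "a > 3 * real n" using pi_gt3 unfolding a_def by linarith
  have "a > 1" using a n2 by simp
  moreover have "a > 1 / e" using a n n2 by linarith
  ultimately have "0 < 1 / a" "1 / a \<le> 1" "1 / a < e" using assms(2) by (auto simp: field_simps)
  moreover have "sin (1 / (1 / a)) = z"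
    using assms(1) sin.plus_of_nat[of "arcsin z" n] by (simp add: a_def abs_le_iff mult_ac)
  ultimately show ?thesis using that by blast
qed

section \<open>Paths can reach the surface only through the end of the arc\<close>

locale surface_axis_arc =
  fixes g :: "real \<Rightarrow> real^3"
  assumes arc_g: "arc g"
    and start_g: "pathstart g \<in> central_axis"
    and finish_g: "pathfinish g \<in> surface_portion"
    and meet_g: "path_image g \<inter> (surface_portion \<union> central_axis) = {pathstart g, pathfinish g}"
begin

definition spine :: "(real^3) set" where
  "spine = central_axis \<union> path_image g"

abbreviation gate :: "real^3" where
  "gate \<equiv> pathfinish g"

abbreviation Y :: "(real^3) set" where
  "Y \<equiv> space_Y (path_image g)"

lemma Y_eq: "Y = surface_portion \<union> spine"
  by (auto simp: space_Y_def spine_def)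

lemma surface_spine: "surface_portion \<inter> spine = {gate}"
proof -
  have "surface_portion \<inter> spine = surface_portion \<inter> {pathstart g, gate}"
    using meet_g surface_axis_disjoint unfolding spine_def by blast
  moreover have "pathstart g \<notin> surface_portion" using start_g surface_axis_disjoint by blast
  ultimately show ?thesis using finish_g by (simp add: Int_insert_right)
qed

lemma gate_mem [simp]: "gate \<in> surface_portion" "gate \<in> spine"
  using surface_spine by (metis IntE insertI1)+

lemma eq_gate: "\<lbrakk>p \<in> surface_portion; p \<in> spine\<rbrakk> \<Longrightarrow> p = gate"
  using surface_spine by (metis IntI singletonD)

lemma central_axis_eq_image: "central_axis = (\<lambda>z. z *\<^sub>R axis 3 1) ` {-1..1}"
proof -
  have "vector [0, 0, z] = z *\<^sub>R (axis 3 1 :: real^3)" for z :: real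
    by (rule vec_eq_iff[THEN iffD2])
       (simp only: forall_3 vector_3 vector_scaleR_component axis_def vec_lambda_beta, simp)
  then show ?thesis by (auto simp: central_axis_def)
qed

lemma convex_central_axis: "convex central_axis"
  unfolding central_axis_eq_image
  by (intro convex_linear_image bounded_linear.linear bounded_linear_scaleR_left convex_real_interval)

lemma closed_central_axis: "closed central_axis"
  unfolding central_axis_eq_image
  by (rule compact_imp_closed, rule compact_continuous_image) (intro continuous_intros, simp)

lemma closed_spine: "closed spine"
  unfolding spine_def
  by (intro closed_Un closed_central_axis closed_path_image arc_imp_path arc_g)

text \<open>Suppose that the gate is missed, and look at the last time \<open>m\<close> at which the path is on the spine.
  Right after \<open>m\<close> it moves on the surface. If its shadow tends to a nonzero point, the limit point lies on the surface as well, so it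
  is the gate. If its shadow tends to \<open>0\<close>, the distance to the axis takes all small positive values
  right after \<open>m\<close>, so the height takes both values \<open>1\<close> and \<open>-1\<close> there, which contradicts
  continuity.\<close>

lemma path_spine_to_surface_meets_gate:
  assumes p: "path p" "path_image p \<subseteq> Y"
    and 0: "p 0 \<in> spine" and 1: "p 1 \<in> surface_portion"
  shows "gate \<in> path_image p"
proof (rule ccontr)
  assume gate: "gate \<notin> path_image p"
  have cont: "continuous_on {0..1} p" using p(1) by (simp add: path_def)
  have pY: "p t \<in> Y" if "t \<in> {0..1}" for t using p(2) that by (auto simp: path_image_def)
  have pg: "p t \<noteq> gate" if "t \<in> {0..1}" for t using gate that by (metis imageI path_image_def)
  define B where "B = {0..1} \<inter> p -` spine"
  have "closed B" unfolding B_def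
    using continuous_closed_preimage[OF cont _ closed_spine] by simp
  then have "compact B" unfolding B_def
    by (metis compact_Icc compact_Int_closed inf.left_idem)
  moreover have "0 \<in> B" using 0 by (simp add: B_def)
  ultimately obtain m where m: "m \<in> B" and max: "\<And>t. t \<in> B \<Longrightarrow> t \<le> m"
    using compact_attains_sup[of B] by blast
  have "1 \<notin> B" using 1 surface_spine pg[of 1] by (auto simp: B_def)
  then have m01: "0 \<le> m" "m < 1" "p m \<in> spine" using m by (auto simp: B_def less_le)
  have S: "p t \<in> surface_portion" if "m < t" "t \<le> 1" for t
    using max[of t] pY[of t] that m01 by (auto simp: B_def Y_eq)
  define w where "w = shadow \<circ> p"
  have contw: "continuous_on {0..1} w"
    unfolding w_def by (intro continuous_on_compose cont continuous_on_shadow)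
  show False
  proof (cases "w m = 0")
    case False
    have ne: "at m within {m<..1} \<noteq> bot"
      using m01 by (simp add: trivial_limit_within islimpt_Ioc)
    have sub: "{m<..1} \<subseteq> {0..1}" using m01 by auto
    have lim: "(p \<longlongrightarrow> p m) (at m within {m<..1})" "(w \<longlongrightarrow> w m) (at m within {m<..1})"
      using cont contw m01 sub
      by (meson atLeastAtMost_iff continuous_on_def less_imp_le tendsto_within_subset)+
    have ev: "\<forall>\<^sub>F t in at m within {m<..1}. t \<in> {m<..1}"
      by (simp add: eventually_at_filter)
    have "continuous_on (- {0}) graph_pt" by (intro continuous_on_graph_pt) simp
    then have "isCont graph_pt (w m)" using False by (simp add: continuous_on_eq_continuous_at open_Compl)
    then have "((\<lambda>t. graph_pt (w t)) \<longlongrightarrow> graph_pt (w m)) (at m within {m<..1})"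
      using lim(2) isCont_tendsto_compose by blast
    moreover have "\<forall>\<^sub>F t in at m within {m<..1}. graph_pt (w t) = p t"
      using ev by eventually_elim (use S in \<open>simp add: w_def\<close>)
    ultimately have "(p \<longlongrightarrow> graph_pt (w m)) (at m within {m<..1})"
      using Lim_transform_eventually by blast
    then have pm: "p m = graph_pt (w m)" using lim(1) ne tendsto_unique by blast
    have "\<forall>\<^sub>F t in at m within {m<..1}. cmod (w t) \<le> 1"
      using ev by eventually_elim (use S shadow_surface in \<open>fastforce simp: w_def punctured_disc_def\<close>)
    then have "cmod (w m) \<le> 1" using Lim_norm_ubound[OF ne lim(2)] by simp
    then have "p m \<in> surface_portion"
      using False unfolding pm surface_portion_eq_graph by (auto simp: punctured_disc_def)
    then show False using m01 surface_spine pg[of m] by auto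
  next
    case True
    have "continuous_on {0..1} (\<lambda>t. p t $ 3)" using cont by (intro continuous_intros)
    then obtain d where d: "d > 0"
      "\<And>t. \<lbrakk>t \<in> {0..1}; dist t m < d\<rbrakk> \<Longrightarrow> dist (p t $ 3) (p m $ 3) < 1"
      using m01 unfolding continuous_on_iff by (metis atLeastAtMost_iff less_imp_le zero_less_one)
    define b where "b = min (m + d / 2) 1"
    have b: "m < b" "b \<le> 1" "b - m < d" using d(1) m01 by (auto simp: b_def)
    have wb: "0 < cmod (w b)"
      using shadow_surface[OF S[of b]] b by (auto simp: w_def punctured_disc_def)
    have near: "dist z (p m $ 3) < 1" if z: "\<bar>z\<bar> \<le> 1" for z
    proof -
      obtain r where r: "0 < r" "r < cmod (w b)" "sin (1 / r) = z"
        using small_radius_of_height[OF z wb] by metis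
      have "continuous_on {m..b} (\<lambda>t. cmod (w t))"
        using b m01 by (intro continuous_intros continuous_on_subset[OF contw]) auto
      then obtain t where t: "m \<le> t" "t \<le> b" "cmod (w t) = r"
        using IVT'[of "\<lambda>t. cmod (w t)" m r b] True r b by auto
      then have "t \<noteq> m" using True r by auto
      then have "p t $ 3 = z" using S[of t] t b r surface_height[of "p t"] by (simp add: w_def)
      moreover have "dist (p t $ 3) (p m $ 3) < 1"
        using t b m01 by (intro d(2)) (auto simp: dist_real_def)
      ultimately show ?thesis by simp
    qed
    show False using near[of 1] near[of "-1"] by (simp add: dist_real_def)
  qed
qed

lemma path_between_surface_and_spine_meets_gate:
  assumes p: "path p" "path_image p \<subseteq> Y"
    and s: "s \<in> path_image p" "s \<in> surface_portion"
    and c: "c \<in> path_image p" "c \<in> spine"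
  shows "gate \<in> path_image p"
proof -
  obtain a b where ab: "a \<in> {0..1}" "b \<in> {0..1}" "p a = c" "p b = s"
    using s c by (auto simp: path_image_def)
  have sub: "path_image (subpath a b p) \<subseteq> path_image p"
    using ab by (intro path_image_subpath_subset) auto
  have "gate \<in> path_image (subpath a b p)"
    using p ab s c sub
    by (intro path_spine_to_surface_meets_gate path_subpath order_trans[OF sub]) (auto simp: subpath_def)
  then show ?thesis using sub by blast
qed

section \<open>Collapsing the spine\<close>

definition collapse :: "real^3 \<Rightarrow> complex" where
  "collapse p = (if p \<in> surface_portion then shadow p else shadow gate)"

lemma collapse_surface [simp]: "p \<in> surface_portion \<Longrightarrow> collapse p = shadow p"
  by (simp add: collapse_def)

lemma collapse_spine [simp]: "p \<in> spine \<Longrightarrow> collapse p = shadow gate"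
  using eq_gate unfolding collapse_def by metis

lemma collapse_in: "collapse p \<in> punctured_disc"
  using shadow_surface by (simp add: collapse_def)

lemma collapse_nonzero [simp]: "collapse p \<noteq> 0"
  using collapse_in[of p] by (auto simp: punctured_disc_def)

lemma shadow_gate_nonzero [simp]: "shadow gate \<noteq> 0"
  using collapse_nonzero[of gate] by simp

text \<open>The map \<open>collapse\<close> is not continuous on \<open>Y\<close>, but it is continuous along paths and homotopies:
  near a point that \<open>H\<close> sends to the spine but not to the gate, the images of short segments miss the
  gate, so they cannot reach the surface. Hence the part of the domain over the surface is closed,
  although the surface is not closed in \<open>Y\<close>.\<close>

lemma closedin_surface_preimage:
  fixes H :: "'b::real_normed_vector \<Rightarrow> real^3"
  assumes K: "convex K" "continuous_on K H" "H ` K \<subseteq> Y"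
  shows "closedin (top_of_set K) (K \<inter> H -` surface_portion)"
proof -
  let ?A = "K \<inter> H -` surface_portion"
  have "openin (top_of_set K) (K - ?A)"
    unfolding openin_contains_ball
  proof (intro conjI ballI)
    fix x assume x: "x \<in> K - ?A"
    then have "H x \<noteq> gate" using gate_mem(1) by auto
    then obtain d where d: "d > 0" "\<And>y. \<lbrakk>y \<in> K; dist y x < d\<rbrakk> \<Longrightarrow> dist (H y) (H x) < dist gate (H x)"
      using K(2) x unfolding continuous_on_iff by (metis DiffD1 zero_less_dist_iff)
    have "y \<notin> ?A" if y: "y \<in> ball x d" "y \<in> K" for y
    proof
      assume yA: "y \<in> ?A"
      have seg: "closed_segment x y \<subseteq> K \<inter> ball x d"
        using x y d(1) K(1) by (intro closed_segment_subset convex_Int convex_ball) auto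
      have img: "path_image (H \<circ> linepath x y) = H ` closed_segment x y"
        by (simp add: path_image_compose)
      have "gate \<in> path_image (H \<circ> linepath x y)"
      proof (rule path_between_surface_and_spine_meets_gate)
        show "path (H \<circ> linepath x y)"
          using seg by (intro path_continuous_image continuous_on_subset[OF K(2)]) auto
        show "path_image (H \<circ> linepath x y) \<subseteq> Y" unfolding img using seg K(3) by blast
        show "H y \<in> path_image (H \<circ> linepath x y)" "H x \<in> path_image (H \<circ> linepath x y)"
          unfolding img by auto
        show "H y \<in> surface_portion" using yA by simp
        show "H x \<in> spine" using x K(3) by (auto simp: Y_eq)
      qed
      then obtain z where z: "z \<in> closed_segment x y" "H z = gate" unfolding img by auto
      then have "z \<in> K" "dist z x < d" using seg by (auto simp: dist_commute)
      then show False using d(2)[of z] z by simp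
    qed
    then show "\<exists>e>0. ball x e \<inter> K \<subseteq> K - ?A" using d(1) by (intro exI[of _ d]) blast
  qed auto
  then show ?thesis by (simp add: closedin_def)
qed

lemma closedin_spine_preimage:
  assumes "continuous_on K H"
  shows "closedin (top_of_set K) (K \<inter> H -` spine)"
  using assms closed_spine by (rule continuous_closedin_preimage)

lemma continuous_on_collapse:
  fixes H :: "'b::real_normed_vector \<Rightarrow> real^3"
  assumes K: "convex K" "continuous_on K H" "H ` K \<subseteq> Y"
  shows "continuous_on K (collapse \<circ> H)"
proof -
  let ?A = "K \<inter> H -` surface_portion" and ?B = "K \<inter> H -` spine"
  have eq: "?A \<union> ?B = K" using K(3) by (auto simp: Y_eq)
  have "continuous_on (?A \<union> ?B) (\<lambda>x. if H x \<in> surface_portion then shadow (H x) else shadow gate)"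
  proof (rule continuous_on_cases_local)
    show "closedin (top_of_set (?A \<union> ?B)) ?A" unfolding eq by (rule closedin_surface_preimage[OF K])
    show "closedin (top_of_set (?A \<union> ?B)) ?B" unfolding eq by (rule closedin_spine_preimage[OF K(2)])
    show "continuous_on ?A (\<lambda>x. shadow (H x))"
      by (intro continuous_on_compose2[OF continuous_on_shadow[of UNIV]] continuous_on_subset[OF K(2)]) auto
    show "shadow (H x) = shadow gate"
      if "x \<in> ?A \<and> H x \<notin> surface_portion \<or> x \<in> ?B \<and> H x \<in> surface_portion" for x
      using that eq_gate[of "H x"] by auto
  qed simp
  then show ?thesis by (simp add: eq collapse_def comp_def)
qed

lemma path_collapse: "\<lbrakk>path p; path_image p \<subseteq> Y\<rbrakk> \<Longrightarrow> path (collapse \<circ> p)"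
  using continuous_on_collapse[of "{0..1}" p] by (simp add: path_def path_image_def)

lemma zero_notin_path_image_collapse [simp]: "0 \<notin> path_image (collapse \<circ> p)"
proof
  assume "0 \<in> path_image (collapse \<circ> p)"
  then obtain t where "collapse (p t) = 0" by (auto simp: path_image_def)
  then show False by simp
qed

lemma homotopic_loops_collapse:
  assumes "homotopic_loops Y p q"
  shows "homotopic_loops (- {0}) (collapse \<circ> p) (collapse \<circ> q)"
proof -
  obtain h where h: "continuous_on ({0..1::real} \<times> {0..1}) h" "h \<in> ({0..1} \<times> {0..1}) \<rightarrow> Y"
    "\<forall>x\<in>{0..1}. h (0, x) = p x" "\<forall>x\<in>{0..1}. h (1, x) = q x"
    "\<forall>t\<in>{0..1}. pathfinish (h \<circ> Pair t) = pathstart (h \<circ> Pair t)"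
    using assms unfolding homotopic_loops by blast
  have "continuous_on ({0..1::real} \<times> {0..1}) (collapse \<circ> h)"
    using h(1,2) by (intro continuous_on_collapse convex_Times convex_real_interval) auto
  then show ?thesis
    unfolding homotopic_loops using h(3-5)
    by (intro exI[of _ "collapse \<circ> h"]) (simp add: pathfinish_def pathstart_def)
qed

lemma homotopic_paths_collapse:
  assumes "homotopic_paths Y p q"
  shows "homotopic_paths (- {0}) (collapse \<circ> p) (collapse \<circ> q)"
proof -
  obtain h where h: "continuous_on ({0..1::real} \<times> {0..1}) h" "h \<in> ({0..1} \<times> {0..1}) \<rightarrow> Y"
    "\<forall>x\<in>{0..1}. h (0, x) = p x" "\<forall>x\<in>{0..1}. h (1, x) = q x"
    "\<forall>t\<in>{0..1}. pathstart (h \<circ> Pair t) = pathstart p \<and> pathfinish (h \<circ> Pair t) = pathfinish p"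
    using assms unfolding homotopic_paths by blast
  have "continuous_on ({0..1::real} \<times> {0..1}) (collapse \<circ> h)"
    using h(1,2) by (intro continuous_on_collapse convex_Times convex_real_interval) auto
  then show ?thesis
    unfolding homotopic_paths using h(3-5)
    by (intro exI[of _ "collapse \<circ> h"]) (simp add: pathfinish_def pathstart_def)
qed

section \<open>Winding numbers classify the paths in the space\<close>

definition winding :: "(real \<Rightarrow> real^3) \<Rightarrow> complex" where
  "winding p = winding_number (collapse \<circ> p) 0"

lemma winding_join:
  assumes "path p" "path_image p \<subseteq> Y" "path q" "path_image q \<subseteq> Y" "pathfinish p = pathstart q"
  shows "winding (p +++ q) = winding p + winding q"
  unfolding winding_def path_compose_join
  using assms by (intro winding_number_join path_collapse) (auto simp: pathfinish_compose pathstart_compose)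

lemma winding_reversepath:
  assumes "path p" "path_image p \<subseteq> Y"
  shows "winding (reversepath p) = - winding p"
  unfolding winding_def path_compose_reversepath
  using assms by (intro winding_number_reversepath path_collapse) auto

lemma winding_const [simp]: "winding (linepath x x) = 0"
proof -
  have "collapse \<circ> linepath x x = linepath (collapse x) (collapse x)"
    by (simp add: linepath_refl comp_def)
  then show ?thesis by (simp add: winding_def)
qed

lemma winding_conjugate:
  assumes "path u" "path_image u \<subseteq> Y" "v \<in> loops_at Y (pathfinish u)"
  shows "winding (u +++ v +++ reversepath u) = winding v"
  using assms by (simp add: winding_join winding_reversepath loops_at_def path_image_join)

lemma homotopic_loops_imp_winding_eq: "homotopic_loops Y p q \<Longrightarrow> winding p = winding q"
  unfolding winding_def by (intro winding_number_homotopic_loops homotopic_loops_collapse)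

lemma homotopic_paths_imp_winding_eq: "homotopic_paths Y p q \<Longrightarrow> winding p = winding q"
  unfolding winding_def by (intro winding_number_homotopic_paths homotopic_paths_collapse)

lemma AR_spine: "AR spine"
  unfolding spine_def
proof (rule AR_closed_Un)
  show "closed central_axis" by (rule closed_central_axis)
  show "closed (path_image g)" using arc_g by (simp add: arc_imp_path closed_path_image)
  show "AR central_axis" using convex_central_axis start_g by (intro convex_imp_AR) auto
  have "path_image g homeomorphic {0..1::real}" using arc_g by (intro homeomorphic_arc_image_interval) auto
  moreover have "AR {0..1::real}" by (intro convex_imp_AR) auto
  ultimately show "AR (path_image g)" using homeomorphic_AR_iff_AR by blast
  have "central_axis \<inter> path_image g = central_axis \<inter> {pathstart g, gate}" using meet_g by blast
  moreover have "gate \<notin> central_axis" using gate_mem(1) surface_axis_disjoint by blast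
  ultimately have "central_axis \<inter> path_image g = {pathstart g}" using start_g by auto
  then show "AR (central_axis \<inter> path_image g)" by (simp add: convex_imp_AR)
qed

text \<open>A strong deformation retraction of the spine to the gate: because the spine is an absolute retract,
  the values prescribed at the two ends and on the track of the gate extend to the whole cylinder.\<close>

lemma spine_contraction:
  obtains M :: "real \<times> (real^3) \<Rightarrow> real^3"
  where "continuous_on ({0..1} \<times> spine) M" "M ` ({0..1} \<times> spine) \<subseteq> spine"
    "\<forall>c\<in>spine. M (0, c) = c" "\<forall>c\<in>spine. M (1, c) = gate" "\<forall>s\<in>{0..1}. M (s, gate) = gate"
proof -
  define T1 where "T1 = {0::real} \<times> spine"
  define T2 where "T2 = {1::real} \<times> spine \<union> {0..1} \<times> {gate}"
  define f :: "real \<times> (real^3) \<Rightarrow> real^3" where "f = (\<lambda>(s, c). if s = 0 then c else gate)"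
  have closed: "closed T1" "closed T2"
    unfolding T1_def T2_def using closed_spine by (auto intro!: closed_Times)
  have "continuous_on T1 f \<longleftrightarrow> continuous_on T1 snd"
    by (rule continuous_on_cong) (auto simp: T1_def f_def)
  moreover have "continuous_on T2 f \<longleftrightarrow> continuous_on T2 (\<lambda>_. gate)"
    by (rule continuous_on_cong) (auto simp: T2_def f_def)
  ultimately have "continuous_on (T1 \<union> T2) f"
    using closed by (intro continuous_on_closed_Un) (auto intro: continuous_intros)
  moreover have "f ` (T1 \<union> T2) \<subseteq> spine" by (auto simp: T1_def T2_def f_def)
  moreover have "closedin (top_of_set ({0..1} \<times> spine)) (T1 \<union> T2)"
    using closed by (intro closed_subset closed_Un) (auto simp: T1_def T2_def)
  ultimately obtain M where "continuous_on ({0..1} \<times> spine) M" "M ` ({0..1} \<times> spine) \<subseteq> spine"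
    and M: "\<And>x. x \<in> T1 \<union> T2 \<Longrightarrow> M x = f x"
    using AR_imp_absolute_extensor[OF AR_spine] by metis
  then show ?thesis
    by (intro that[of M]) (auto simp: T1_def T2_def f_def)
qed

text \<open>In the convex square, one side is homotopic to the path along the other three sides.\<close>

lemma homotopic_paths_across_square:
  fixes G :: "real \<times> real \<Rightarrow> 'a::real_normed_vector"
  assumes "continuous_on ({0..1} \<times> {0..1}) G" "G ` ({0..1} \<times> {0..1}) \<subseteq> X"
  shows "homotopic_paths X (\<lambda>t. G (0, t))
           ((\<lambda>s. G (s, 0)) +++ (\<lambda>t. G (1, t)) +++ reversepath (\<lambda>s. G (s, 1)))"
proof -
  let ?Q = "{0..1::real} \<times> {0..1::real}"
  let ?l = "linepath (0, 0) (0, 1) :: real \<Rightarrow> real \<times> real"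
  let ?r = "linepath (0, 0) (1, 0) +++ linepath (1, 0) (1, 1) +++ reversepath (linepath (0, 1) (1, 1))
     :: real \<Rightarrow> real \<times> real"
  have conv: "convex ?Q" by (intro convex_Times convex_real_interval)
  have "simply_connected ?Q" using conv by (rule convex_imp_simply_connected)
  moreover have "closed_segment a b \<subseteq> ?Q" if "a \<in> ?Q" "b \<in> ?Q" for a b
    using that conv by (rule closed_segment_subset)
  then have "path_image ?l \<subseteq> ?Q" "path_image ?r \<subseteq> ?Q"
    by (simp_all add: path_image_join)
  ultimately have "homotopic_paths ?Q ?l ?r"
    unfolding simply_connected_eq_homotopic_paths by simp
  then have "homotopic_paths X (G \<circ> ?l) (G \<circ> ?r)"
    using assms by (intro homotopic_paths_continuous_image) auto
  then show ?thesis
    unfolding path_compose_join path_compose_reversepath by (simp add: comp_def linepath_def)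
qed

text \<open>Contracting the spine onto the gate moves every path \<open>p\<close> in \<open>Y\<close> to \<open>graph_pt \<circ> collapse \<circ> p\<close>,
  while its ends move along tracks \<open>\<tau>\<close>. The tracks depend only on the end points and not on \<open>p\<close>; this is
  what allows paths with common ends to be compared after the contraction.\<close>

lemma path_homotopic_to_surface_path:
  obtains \<tau> :: "real^3 \<Rightarrow> real \<Rightarrow> real^3"
  where "\<forall>x\<in>Y. path (\<tau> x) \<and> path_image (\<tau> x) \<subseteq> Y \<and> pathfinish (\<tau> x) = graph_pt (collapse x)"
    "\<forall>p. path p \<and> path_image p \<subseteq> Y \<longrightarrow> homotopic_paths Y p
        (\<tau> (pathstart p) +++ (graph_pt \<circ> (collapse \<circ> p)) +++ reversepath (\<tau> (pathfinish p)))"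
proof -
  obtain M :: "real \<times> (real^3) \<Rightarrow> real^3"
    where M: "continuous_on ({0..1} \<times> spine) M" "M ` ({0..1} \<times> spine) \<subseteq> spine"
    "\<forall>c\<in>spine. M (0, c) = c" "\<forall>c\<in>spine. M (1, c) = gate" "\<forall>s\<in>{0..1}. M (s, gate) = gate"
    by (rule spine_contraction)
  define D where "D s y = (if y \<in> surface_portion then y else M (s, y))" for s y
  have D_spine: "D s y = M (s, y)" if "y \<in> spine" "s \<in> {0..1}" for s y
  proof (cases "y \<in> surface_portion")
    case True
    then have "y = gate" using that eq_gate by metis
    then show ?thesis using that M(5) by (simp add: D_def)
  qed (simp add: D_def)
  have D_in: "D s y \<in> Y" if "y \<in> Y" "s \<in> {0..1}" for s y
    using that M(2) unfolding D_def Y_eq image_subset_iff by auto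
  have D0: "D 0 y = y" if "y \<in> Y" for y
    using that M(3) unfolding D_def Y_eq by (metis UnE)
  have D1: "D 1 y = graph_pt (collapse y)" if "y \<in> Y" for y
  proof (cases "y \<in> surface_portion")
    case False
    then have "y \<in> spine" using that by (simp add: Y_eq)
    then show ?thesis using False M(4) by (simp add: D_def)
  qed (simp add: D_def)
  have square: "continuous_on ({0..1} \<times> {0..1}) (\<lambda>(s, t). D s (p t))"
    if p: "path p" "path_image p \<subseteq> Y" for p
  proof -
    have cont: "continuous_on {0..1} p" "p ` {0..1} \<subseteq> Y" using p by (auto simp: path_def path_image_def)
    define A where "A = {0..1} \<inter> p -` surface_portion"
    define B where "B = {0..1} \<inter> p -` spine"
    have "closed A" "closed B"
      using closedin_surface_preimage[of "{0..1}" p] closedin_spine_preimage[of "{0..1}" p] cont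
      by (auto simp: A_def B_def intro: closedin_closed_trans)
    then have "closed ({0..1::real} \<times> A)" "closed ({0..1::real} \<times> B)" by (auto intro: closed_Times)
    moreover have "continuous_on ({0..1} \<times> A) (\<lambda>(s, t). D s (p t))
        \<longleftrightarrow> continuous_on ({0..1::real} \<times> A) (\<lambda>x. p (snd x))"
      by (rule continuous_on_cong) (auto simp: A_def D_def)
    moreover have "continuous_on ({0..1::real} \<times> A) (\<lambda>x. p (snd x))"
      by (intro continuous_on_compose2[OF cont(1)] continuous_intros) (auto simp: A_def)
    moreover have "continuous_on ({0..1} \<times> B) (\<lambda>(s, t). D s (p t))
        \<longleftrightarrow> continuous_on ({0..1::real} \<times> B) (\<lambda>x. M (fst x, p (snd x)))"
      by (rule continuous_on_cong) (auto simp: B_def D_spine)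
    moreover have "continuous_on ({0..1::real} \<times> B) (\<lambda>x. M (fst x, p (snd x)))"
      by (intro continuous_on_compose2[OF M(1)] continuous_on_Pair continuous_on_compose2[OF cont(1)]
          continuous_intros) (auto simp: B_def)
    ultimately have "continuous_on ({0..1} \<times> A \<union> {0..1} \<times> B) (\<lambda>(s, t). D s (p t))"
      by (intro continuous_on_closed_Un) auto
    moreover have "{0..1::real} \<times> A \<union> {0..1} \<times> B = {0..1} \<times> {0..1}"
      using cont(2) by (auto simp: A_def B_def Y_eq)
    ultimately show ?thesis by simp
  qed
  show ?thesis
  proof (rule that[of "\<lambda>x s. D s x"]; intro ballI allI impI)
    fix x assume x: "x \<in> Y"
    have "continuous_on ({0..1} \<times> {0..1}) (\<lambda>(s, t). D s (linepath x x t))"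
      by (intro square path_linepath, unfold path_image_linepath) (use x in simp)
    then have "continuous_on {0..1::real} (\<lambda>s. (\<lambda>(s, t). D s (linepath x x t)) (s, 0))"
      by (rule continuous_on_compose2) (auto intro!: continuous_intros)
    then show "path (\<lambda>s. D s x) \<and> path_image (\<lambda>s. D s x) \<subseteq> Y \<and>
        pathfinish (\<lambda>s. D s x) = graph_pt (collapse x)"
      using D_in[OF x] D1[OF x] by (auto simp: path_def path_image_def pathfinish_def linepath_refl)
  next
    fix p assume "path p \<and> path_image p \<subseteq> Y"
    then have p: "path p" "path_image p \<subseteq> Y" by blast+
    then have pY: "p t \<in> Y" if "t \<in> {0..1}" for t using that by (auto simp: path_image_def)
    let ?G = "\<lambda>(s, t). D s (p t)"
    let ?\<tau> = "\<lambda>x s. D s x" and ?\<rho> = "graph_pt \<circ> (collapse \<circ> p)"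
    have "homotopic_paths Y (\<lambda>t. ?G (0, t))
        ((\<lambda>s. ?G (s, 0)) +++ (\<lambda>t. ?G (1, t)) +++ reversepath (\<lambda>s. ?G (s, 1)))"
      using square[OF p] D_in pY by (intro homotopic_paths_across_square) auto
    then have *: "homotopic_paths Y (\<lambda>t. D 0 (p t))
        (?\<tau> (p 0) +++ (\<lambda>t. D 1 (p t)) +++ reversepath (?\<tau> (p 1)))" by simp
    have "homotopic_paths Y p (\<lambda>t. D 0 (p t))"
      using p D0 pY by (intro homotopic_paths_eq) auto
    moreover have "homotopic_paths Y (?\<tau> (p 0) +++ (\<lambda>t. D 1 (p t)) +++ reversepath (?\<tau> (p 1)))
        (?\<tau> (p 0) +++ ?\<rho> +++ reversepath (?\<tau> (p 1)))"
      using homotopic_paths_imp_path[OF *] homotopic_paths_imp_subset[OF *] D1 pY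
      by (intro homotopic_paths_eq) (auto simp: joinpaths_def)
    ultimately have "homotopic_paths Y p (?\<tau> (p 0) +++ ?\<rho> +++ reversepath (?\<tau> (p 1)))"
      using * homotopic_paths_trans by blast
    then show "homotopic_paths Y p
        (?\<tau> (pathstart p) +++ ?\<rho> +++ reversepath (?\<tau> (pathfinish p)))"
      by (simp add: pathstart_def pathfinish_def)
  qed
qed

text \<open>Classification by winding numbers takes place in the punctured plane. Its radial retraction to the
  punctured disc, followed by the parametrisation of the surface, carries homotopies back into \<open>Y\<close>.\<close>

definition to_surface :: "complex \<Rightarrow> real^3" where
  "to_surface w = graph_pt (w /\<^sub>R max 1 (cmod w))"

lemma to_surface_collapse: "to_surface \<circ> (collapse \<circ> p) = graph_pt \<circ> (collapse \<circ> p)"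
proof
  fix t
  have "cmod (collapse (p t)) \<le> 1" using collapse_in[of "p t"] by (simp add: punctured_disc_def)
  then show "(to_surface \<circ> (collapse \<circ> p)) t = (graph_pt \<circ> (collapse \<circ> p)) t"
    by (simp add: to_surface_def max_absorb1)
qed

lemma continuous_on_to_surface: "continuous_on (- {0}) to_surface"
  unfolding to_surface_def
  by (intro continuous_on_compose2[OF continuous_on_graph_pt[of "- {0}"]] continuous_intros)
     (auto simp: max_def split: if_splits)

lemma to_surface_in: "to_surface \<in> - {0} \<rightarrow> surface_portion"
  unfolding surface_portion_eq_graph to_surface_def
  by (auto simp: punctured_disc_def max_def divide_simps intro!: imageI)

lemma winding_eq_imp_homotopic_paths:
  assumes p: "path p" "path_image p \<subseteq> Y" and q: "path q" "path_image q \<subseteq> Y"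
    and ends: "pathstart q = pathstart p" "pathfinish q = pathfinish p"
    and eq: "winding p = winding q"
  shows "homotopic_paths Y p q"
proof -
  obtain \<tau> where \<tau>: "\<forall>x\<in>Y. path (\<tau> x) \<and> path_image (\<tau> x) \<subseteq> Y \<and> pathfinish (\<tau> x) = graph_pt (collapse x)"
    and conj: "\<forall>p. path p \<and> path_image p \<subseteq> Y \<longrightarrow> homotopic_paths Y p
        (\<tau> (pathstart p) +++ (graph_pt \<circ> (collapse \<circ> p)) +++ reversepath (\<tau> (pathfinish p)))"
    by (rule path_homotopic_to_surface_path)
  have "homotopic_paths (- {0}) (collapse \<circ> p) (collapse \<circ> q)"
    using p q ends eq winding_number_homotopic_paths_eq[of "collapse \<circ> p" 0 "collapse \<circ> q"]
    by (simp add: path_collapse winding_def pathstart_compose pathfinish_compose)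
  then have "homotopic_paths surface_portion (to_surface \<circ> (collapse \<circ> p)) (to_surface \<circ> (collapse \<circ> q))"
    by (rule homotopic_paths_continuous_image[OF _ continuous_on_to_surface to_surface_in])
  then have mid: "homotopic_paths Y (graph_pt \<circ> (collapse \<circ> p)) (graph_pt \<circ> (collapse \<circ> q))"
    unfolding to_surface_collapse by (rule homotopic_paths_subset) (auto simp: Y_eq)
  have "pathstart p \<in> Y" "pathfinish p \<in> Y" using p by auto
  note \<tau>' = \<tau>[rule_format, OF this(1)] \<tau>[rule_format, OF this(2)]
  have "homotopic_paths Y
      (\<tau> (pathstart p) +++ (graph_pt \<circ> (collapse \<circ> p)) +++ reversepath (\<tau> (pathfinish p)))
      (\<tau> (pathstart p) +++ (graph_pt \<circ> (collapse \<circ> q)) +++ reversepath (\<tau> (pathfinish p)))"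
    using mid \<tau>' by (intro homotopic_paths_join) (auto simp: pathstart_compose pathfinish_compose)
  then show ?thesis
    using homotopic_paths_trans[OF homotopic_paths_trans[OF conj[rule_format, of p]]]
      homotopic_paths_sym[OF conj[rule_format, of q]] p q unfolding ends by blast
qed

lemma path_class_eq_one_iff:
  assumes "p \<in> loops_at Y x"
  shows "path_class Y p = \<one>\<^bsub>fund_group Y x\<^esub> \<longleftrightarrow> winding p = 0"
proof -
  have p: "path p" "path_image p \<subseteq> Y" "pathstart p = x" "pathfinish p = x"
    using assms by (auto simp: loops_at_def)
  then have x: "x \<in> Y" by auto
  have "path_class Y p = path_class Y (linepath x x) \<longleftrightarrow> homotopic_paths Y p (linepath x x)"
    using p by (intro path_class_eq_iff)
  also have "\<dots> \<longleftrightarrow> winding p = 0"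
    using homotopic_paths_imp_winding_eq[of p "linepath x x"] p x
      winding_eq_imp_homotopic_paths[of p "linepath x x"] by auto
  finally show ?thesis by (simp add: one_fund_group)
qed

section \<open>Based loops near a point\<close>

text \<open>If \<open>x\<close> is not the gate, a ball that misses the gate keeps the path on the same one of the two
  pieces as \<open>x\<close>; if \<open>x\<close> is the gate, both pieces are allowed. On the spine \<open>collapse\<close> is constant. On the
  surface it does not increase distances, and the radius \<open>cmod (collapse x)\<close> keeps the shadow in a disc
  that misses \<open>0\<close>. That the path passes through \<open>x\<close> is essential: every ball around a point of the
  axis also contains circles of the surface.\<close>

lemma collapse_near_point:
  assumes x: "x \<in> Y"
  obtains e where "0 < e"
    "\<forall>(a::real) b q. continuous_on {a..b} q \<longrightarrow> q ` {a..b} \<subseteq> Y \<inter> ball x e \<longrightarrow> x \<in> q ` {a..b}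
        \<longrightarrow> (collapse \<circ> q) ` {a..b} \<subseteq> ball (collapse x) (cmod (collapse x))"
proof -
  define e where "e = (if x = gate then cmod (collapse x) else min (cmod (collapse x)) (dist x gate))"
  have "(collapse \<circ> q) ` {a..b} \<subseteq> ball (collapse x) (cmod (collapse x))"
    if q: "continuous_on {a..b} q" "q ` {a..b} \<subseteq> Y \<inter> ball x e" "x \<in> q ` {a..b}"
    for a b :: real and q
  proof clarify
    fix t assume t: "t \<in> {a..b}"
    obtain u where u: "u \<in> {a..b}" "q u = x" using q(3) by blast
    have qt: "q t \<in> Y" "dist x (q t) < e" using q(2) t by (auto simp: image_subset_iff)
    have same_piece: "x \<in> surface_portion \<longleftrightarrow> q t \<in> surface_portion" if "x \<noteq> gate"
    proof (rule ccontr)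
      assume differ: "\<not> ?thesis"
      have seg: "closed_segment u t \<subseteq> {a..b}"
        by (intro closed_segment_subset convex_real_interval u t)
      have img: "path_image (q \<circ> linepath u t) = q ` closed_segment u t"
        by (simp add: path_image_compose)
      have path: "path (q \<circ> linepath u t)" "path_image (q \<circ> linepath u t) \<subseteq> Y"
        using seg q(2) unfolding img
        by (auto intro!: path_continuous_image continuous_on_subset[OF q(1)])
      have ends: "x \<in> path_image (q \<circ> linepath u t)" "q t \<in> path_image (q \<circ> linepath u t)"
        unfolding img using u(2) by auto
      have "gate \<in> path_image (q \<circ> linepath u t)"
      proof (cases "x \<in> surface_portion")
        case True
        then have "q t \<in> spine" using differ qt(1) by (auto simp: Y_eq)
        then show ?thesis using True path ends by (intro path_between_surface_and_spine_meets_gate)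
      next
        case False
        then have "x \<in> spine" "q t \<in> surface_portion" using differ x by (auto simp: Y_eq)
        then show ?thesis using path ends by (intro path_between_surface_and_spine_meets_gate)
      qed
      then have "gate \<in> ball x e" using q(2) seg unfolding img by blast
      then show False using that by (simp add: e_def)
    qed
    have "dist (collapse x) (collapse (q t)) < cmod (collapse x)"
    proof (cases "x \<in> surface_portion \<and> q t \<in> surface_portion")
      case True
      then have "dist (collapse x) (collapse (q t)) \<le> dist x (q t)" by (simp add: dist_shadow_le)
      also have "\<dots> < cmod (collapse x)" using qt(2) by (auto simp: e_def split: if_splits)
      finally show ?thesis .
    next
      case False
      then have "collapse x = shadow gate" "collapse (q t) = shadow gate"
        by (cases "x = gate"; use same_piece in \<open>auto simp: collapse_def\<close>)+
      then show ?thesis using collapse_nonzero[of x] by simp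
    qed
    then show "(collapse \<circ> q) t \<in> ball (collapse x) (cmod (collapse x))" by simp
  qed
  moreover have "0 < e" by (simp add: e_def)
  ultimately show ?thesis by (intro that[of e]) auto
qed

lemma small_based_loops_trivial:
  assumes x: "x \<in> Y"
  obtains U where "openin (top_of_set Y) U" "x \<in> U" "\<forall>p\<in>loops_at U x. winding p = 0"
proof -
  obtain e where e: "0 < e"
    "\<forall>(a::real) b q. continuous_on {a..b} q \<longrightarrow> q ` {a..b} \<subseteq> Y \<inter> ball x e \<longrightarrow> x \<in> q ` {a..b}
        \<longrightarrow> (collapse \<circ> q) ` {a..b} \<subseteq> ball (collapse x) (cmod (collapse x))"
    by (rule collapse_near_point[OF x])
  have "winding p = 0" if "p \<in> loops_at (Y \<inter> ball x e) x" for p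
  proof -
    have p: "path p" "path_image p \<subseteq> Y \<inter> ball x e" "pathstart p = x" "pathfinish p = x"
      using that by (auto simp: loops_at_def)
    have "x \<in> p ` {0..1}" using p(3) by (auto simp: pathstart_def)
    then have "path_image (collapse \<circ> p) \<subseteq> ball (collapse x) (cmod (collapse x))"
      using e(2)[rule_format, of 0 1 p] p by (simp add: path_def path_image_def)
    then show ?thesis
      unfolding winding_def using p
      by (intro winding_number_zero_outside[of _ "ball (collapse x) (cmod (collapse x))"] path_collapse)
         (auto simp: pathstart_compose pathfinish_compose)
  qed
  moreover have "openin (top_of_set Y) (Y \<inter> ball x e)" by (simp add: openin_open_Int)
  ultimately show ?thesis using x e(1) by (intro that[of "Y \<inter> ball x e"]) auto
qed

lemma openin_imp_nbhd_in: "\<lbrakk>openin (top_of_set Y) U; x \<in> U\<rbrakk> \<Longrightarrow> nbhd_in Y x U"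
  unfolding nbhd_in_def using openin_imp_subset by blast

lemma based_semilocally_simply_connected_Y: "based_semilocally_simply_connected Y"
  unfolding based_semilocally_simply_connected_def
proof
  fix x assume "x \<in> Y"
  then obtain U where U: "openin (top_of_set Y) U" "x \<in> U" "\<forall>p\<in>loops_at U x. winding p = 0"
    by (rule small_based_loops_trivial)
  have "incl_hom Y \<alpha> = \<one>\<^bsub>fund_group Y x\<^esub>" if "\<alpha> \<in> carrier (fund_group U x)" for \<alpha>
  proof -
    obtain p where p: "p \<in> loops_at U x" "\<alpha> = path_class U p"
      using \<open>\<alpha> \<in> carrier (fund_group U x)\<close> by (auto simp: carrier_fund_group)
    have "U \<subseteq> Y" using U(1) by (rule openin_imp_subset)
    then have "incl_hom Y \<alpha> = path_class Y p"
      using p unfolding loops_at_def by (simp add: incl_hom_path_class)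
    moreover have "p \<in> loops_at Y x" using \<open>U \<subseteq> Y\<close> p(1) loops_at_mono by blast
    ultimately show ?thesis using U(3) p(1) path_class_eq_one_iff by simp
  qed
  then show "\<exists>U. nbhd_in Y x U \<and> (\<forall>\<alpha>\<in>carrier (fund_group U x). incl_hom Y \<alpha> = \<one>\<^bsub>fund_group Y x\<^esub>)"
    using openin_imp_nbhd_in[OF U(1,2)] by blast
qed

lemma homotopically_Hausdorff_Y: "homotopically_Hausdorff Y"
  unfolding homotopically_Hausdorff_def
proof (intro ballI impI)
  fix x \<alpha> assume x: "x \<in> Y" and \<alpha>: "\<alpha> \<noteq> \<one>\<^bsub>fund_group Y x\<^esub>"
  obtain U where U: "openin (top_of_set Y) U" "x \<in> U" "\<forall>p\<in>loops_at U x. winding p = 0"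
    by (rule small_based_loops_trivial[OF x])
  have "loops_at U x \<subseteq> loops_at Y x" by (intro loops_at_mono openin_imp_subset[OF U(1)])
  then have "\<forall>p\<in>loops_at U x. path_class Y p \<noteq> \<alpha>" using U(3) \<alpha> path_class_eq_one_iff by (metis subsetD)
  then show "\<exists>U. nbhd_in Y x U \<and> (\<forall>p\<in>loops_at U x. path_class Y p \<noteq> \<alpha>)"
    using openin_imp_nbhd_in[OF U(1,2)] by blast
qed

lemma conj_product_winding_zero:
  assumes "x \<in> Y" "\<And>u v. (u, v) \<in> set uvs \<Longrightarrow>
      path u \<and> path_image u \<subseteq> Y \<and> pathstart u = x \<and> v \<in> loops_at Y (pathfinish u) \<and> winding v = 0"
  shows "winding (conj_product x uvs) = 0"
  using assms(2)
proof (induction uvs)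
  case Nil
  show ?case unfolding conj_product.simps by (rule winding_const)
next
  case (Cons c uvs)
  obtain u v where c: "c = (u, v)" by force
  have u: "path u" "path_image u \<subseteq> Y" "pathstart u = x" "v \<in> loops_at Y (pathfinish u)" "winding v = 0"
    using Cons.prems[of u v] c by auto
  have IH: "winding (conj_product x uvs) = 0" using Cons.prems by (intro Cons.IH) (meson list.set_intros(2))
  have tail: "conj_product x uvs \<in> loops_at Y x"
    using Cons.prems by (intro conj_product_in_loops_at assms(1)) (meson list.set_intros(2))
  have "u +++ v +++ reversepath u \<in> loops_at Y x"
    using u by (auto simp: loops_at_def path_image_join)
  then have "winding (conj_product x (c # uvs)) = winding (u +++ v +++ reversepath u)"
    using tail IH by (simp add: c winding_join loops_at_def)
  then show ?case using winding_conjugate[OF u(1,2,4)] u(5) by simp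
qed

lemma based_spanier_group_trivial:
  assumes x: "x \<in> Y"
  shows "based_spanier_group Y x = {\<one>\<^bsub>fund_group Y x\<^esub>}"
proof -
  have "\<forall>y\<in>Y. \<exists>U. openin (top_of_set Y) U \<and> y \<in> U \<and> (\<forall>p\<in>loops_at U y. winding p = 0)"
    using small_based_loops_trivial by metis
  then obtain U where U: "\<forall>y\<in>Y. openin (top_of_set Y) (U y) \<and> y \<in> U y \<and> (\<forall>p\<in>loops_at (U y) y. winding p = 0)"
    by (rule bchoice[THEN exE])
  define \<V> where "\<V> = (\<lambda>y. (U y, y)) ` Y"
  have \<V>: "pointed_open_covering Y \<V>"
    using U by (auto simp: pointed_open_covering_def \<V>_def image_image)
  have "pointed_spanier_subgroup Y x \<V> \<subseteq> {\<one>\<^bsub>fund_group Y x\<^esub>}"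
  proof
    fix \<alpha> assume "\<alpha> \<in> pointed_spanier_subgroup Y x \<V>"
    then obtain uvs where \<alpha>: "\<alpha> = path_class Y (conj_product x uvs)"
      and uvs: "set uvs \<subseteq> {(u, v). path u \<and> path_image u \<subseteq> Y \<and> pathstart u = x
        \<and> (\<exists>(W, y)\<in>\<V>. pathfinish u = y \<and> v \<in> loops_at W y)}"
      unfolding pointed_spanier_subgroup_def conj_product_classes_def by blast
    have *: "path u \<and> path_image u \<subseteq> Y \<and> pathstart u = x \<and> v \<in> loops_at Y (pathfinish u) \<and> winding v = 0"
      if "(u, v) \<in> set uvs" for u v
    proof -
      have u: "path u" "path_image u \<subseteq> Y" "pathstart u = x" and "\<exists>y\<in>Y. pathfinish u = y \<and> v \<in> loops_at (U y) y"
        using uvs that by (auto simp: \<V>_def)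
      then obtain y where y: "y \<in> Y" "pathfinish u = y" "v \<in> loops_at (U y) y" by blast
      have "U y \<subseteq> Y" using U y(1) openin_imp_subset by blast
      then have "v \<in> loops_at Y y" using y(3) loops_at_mono by blast
      then show ?thesis using u y U by simp
    qed
    have "conj_product x uvs \<in> loops_at Y x" using * by (intro conj_product_in_loops_at x) blast
    moreover have "winding (conj_product x uvs) = 0" using * by (intro conj_product_winding_zero x)
    ultimately show "\<alpha> \<in> {\<one>\<^bsub>fund_group Y x\<^esub>}" using path_class_eq_one_iff by (simp add: \<alpha>)
  qed
  then have "based_spanier_group Y x \<subseteq> {\<one>\<^bsub>fund_group Y x\<^esub>}"
    using \<V> unfolding based_spanier_group_def by blast
  moreover have "\<one>\<^bsub>fund_group Y x\<^esub> \<in> based_spanier_group Y x"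
    unfolding based_spanier_group_def
    using subgroup.one_closed[OF subgroup_pointed_spanier_subgroup[OF x]] by blast
  ultimately show ?thesis by blast
qed

section \<open>Small circles around the axis\<close>

definition circle :: "real \<Rightarrow> real \<Rightarrow> real^3" where
  "circle r = graph_pt \<circ> circlepath 0 r"

lemma circlepath_in:
  assumes "0 < r" "r \<le> 1"
  shows "circlepath 0 r t \<in> punctured_disc"
proof -
  have "cmod (circlepath 0 r t) = r" using assms by (simp add: circlepath norm_mult)
  then show ?thesis using assms by (auto simp: punctured_disc_def)
qed

lemma collapse_circle:
  assumes "0 < r" "r \<le> 1"
  shows "collapse \<circ> circle r = circlepath 0 r"
  using circlepath_in[OF assms] by (auto simp: circle_def fun_eq_iff surface_portion_eq_graph)

lemma closed_curve_circle:
  assumes "0 < r" "r \<le> 1"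
  shows "closed_curve_in surface_portion (circle r)"
  unfolding closed_curve_in_def
proof (intro conjI)
  have "0 \<notin> path_image (circlepath 0 r)" using assms by simp
  then show "path (circle r)" unfolding circle_def
    by (intro path_continuous_image continuous_on_graph_pt path_circlepath)
  show "path_image (circle r) \<subseteq> surface_portion"
    using circlepath_in[OF assms] by (auto simp: circle_def path_image_def surface_portion_eq_graph)
qed (simp add: circle_def pathfinish_compose pathstart_compose)

lemma winding_circle: "\<lbrakk>0 < r; r \<le> 1\<rbrakk> \<Longrightarrow> winding (circle r) = 1"
  by (simp add: winding_def collapse_circle winding_number_circlepath_centre)

lemma homotopic_circles:
  assumes r: "0 < r" "r \<le> 1" and s: "0 < s" "s \<le> 1"
  shows "homotopic_loops Y (circle r) (circle s)"
proof -
  have "homotopic_loops (- {0}) (circlepath 0 r) (circlepath 0 s)"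
    using winding_number_homotopic_loops_eq[of "circlepath 0 r" 0 "circlepath 0 s"] r s
    by (simp add: winding_number_circlepath_centre)
  then have "homotopic_loops surface_portion (to_surface \<circ> circlepath 0 r) (to_surface \<circ> circlepath 0 s)"
    by (rule homotopic_loops_continuous_image[OF _ continuous_on_to_surface to_surface_in])
  moreover have "to_surface \<circ> circlepath 0 r = circle r" if "0 < r" "r \<le> 1" for r
    using to_surface_collapse[of "circle r"] collapse_circle[OF that] by (simp add: circle_def)
  ultimately have "homotopic_loops surface_portion (circle r) (circle s)" using r s by simp
  then show ?thesis by (rule homotopic_loops_subset) (auto simp: Y_eq)
qed

lemma circle_essential: "\<lbrakk>0 < r; r \<le> 1\<rbrakk> \<Longrightarrow> \<not> null_homotopic_in Y (circle r)"
  unfolding null_homotopic_in_def using homotopic_loops_imp_winding_eq winding_circle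
  by (metis winding_const zero_neq_one)

lemma origin_in: "0 \<in> Y"
proof -
  have "(0 :: real^3) \<in> central_axis"
    unfolding central_axis_eq_image by (rule image_eqI[of _ _ 0]) auto
  then show ?thesis by (simp add: Y_eq spine_def)
qed

lemma small_circle_near_origin:
  assumes "nbhd_in Y 0 U"
  obtains r where "0 < r" "r \<le> 1" "closed_curve_in U (circle r)"
proof -
  obtain W where W: "openin (top_of_set Y) W" "0 \<in> W" "W \<subseteq> U" using assms by (auto simp: nbhd_in_def)
  then obtain e where e: "0 < e" "ball 0 e \<inter> Y \<subseteq> W" by (meson openin_contains_ball)
  obtain r where r: "0 < r" "r \<le> 1" "r < e" "sin (1 / r) = 0"
    using small_radius_of_height[of 0 e] e(1) by auto
  have "norm (circle r t) = r" for t
  proof -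
    have "cmod (circlepath 0 r t) = r" using r(1) by (simp add: circlepath norm_mult)
    then have "(norm (circle r t))\<^sup>2 = r\<^sup>2"
      using r(4) unfolding power2_norm_eq_inner
      by (simp add: circle_def graph_pt_def inner_vec_def sum_3 cmod_power2[symmetric] flip: power2_eq_square)
    then show ?thesis using r(1) by simp
  qed
  then have "path_image (circle r) \<subseteq> ball 0 e" using r(3) by (auto simp: path_image_def)
  moreover have *: "closed_curve_in surface_portion (circle r)" using r by (intro closed_curve_circle)
  ultimately have "path_image (circle r) \<subseteq> U" using e(2) W(3) by (auto simp: closed_curve_in_def Y_eq)
  then have "closed_curve_in U (circle r)" using * by (simp add: closed_curve_in_def)
  then show ?thesis using r that by blast
qed

lemma not_unbased_semilocally_simply_connected_Y: "\<not> unbased_semilocally_simply_connected Y"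
  unfolding unbased_semilocally_simply_connected_def
  using origin_in circle_essential small_circle_near_origin by metis

lemma not_strongly_homotopically_Hausdorff_Y: "\<not> strongly_homotopically_Hausdorff Y"
proof
  assume "strongly_homotopically_Hausdorff Y"
  moreover have "closed_curve_in Y (circle 1)"
    using closed_curve_circle[of 1] by (auto simp: closed_curve_in_def Y_eq)
  moreover have "\<not> null_homotopic_in Y (circle 1)" by (intro circle_essential) auto
  ultimately obtain U where "nbhd_in Y 0 U"
    and U: "\<forall>\<delta>. closed_curve_in U \<delta> \<longrightarrow> \<not> homotopic_loops Y \<delta> (circle 1)"
    using origin_in unfolding strongly_homotopically_Hausdorff_def by blast
  then obtain r where "0 < r" "r \<le> 1" "closed_curve_in U (circle r)"
    using small_circle_near_origin by metis
  then show False using U homotopic_circles[of r 1] by simp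
qed

lemma path_connected_Y: "path_connected Y"
proof -
  have "surface_portion = (\<lambda>(r, \<phi>). graph_pt (rcis r \<phi>)) ` ({0<..1} \<times> UNIV)"
  proof
    show "surface_portion \<subseteq> (\<lambda>(r, \<phi>). graph_pt (rcis r \<phi>)) ` ({0<..1} \<times> UNIV)"
    proof
      fix p assume "p \<in> surface_portion"
      then obtain r \<phi> where "0 < r" "r \<le> 1" "p = vector [r * cos \<phi>, r * sin \<phi>, sin (1 / r)]"
        by (auto simp: surface_portion_def)
      then show "p \<in> (\<lambda>(r, \<phi>). graph_pt (rcis r \<phi>)) ` ({0<..1} \<times> UNIV)"
        by (intro image_eqI[of _ _ "(r, \<phi>)"]) (auto simp: graph_pt_def)
    qed
  qed (auto simp: surface_portion_eq_graph punctured_disc_def)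
  moreover have "continuous_on ({0<..1} \<times> UNIV) (\<lambda>(r, \<phi>). graph_pt (rcis r \<phi>))"
    unfolding case_prod_unfold
    by (intro continuous_on_compose2[OF continuous_on_graph_pt[of "- {0}"]])
       (auto simp: rcis_def cis_conv_exp intro!: continuous_intros)
  moreover have "path_connected ({0<..1::real} \<times> (UNIV :: real set))"
    by (intro convex_imp_path_connected convex_Times convex_real_interval convex_UNIV)
  ultimately have S: "path_connected surface_portion" using path_connected_continuous_image by metis
  have "path_connected spine" unfolding spine_def
    using convex_central_axis arc_g start_g
    by (intro path_connected_Un convex_imp_path_connected path_connected_path_image)
       (auto simp: arc_imp_path)
  then show ?thesis unfolding Y_eq using S surface_spine by (intro path_connected_Un) auto
qed

text \<open>The class that winds once around the axis lies in every \<open>spanier_subgroup\<close>: any covering set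
  containing the origin contains a small circle, and conjugating it by any path keeps the winding
  number \<open>1\<close>.\<close>

lemma unbased_spanier_group_nontrivial:
  assumes x: "x \<in> Y"
  shows "unbased_spanier_group Y x \<noteq> {\<one>\<^bsub>fund_group Y x\<^esub>}"
proof -
  have conj: "\<exists>u. path u \<and> path_image u \<subseteq> Y \<and> pathstart u = x \<and> circle r \<in> loops_at Y (pathfinish u)
      \<and> pathfinish u = pathstart (circle r)" if r: "0 < r" "r \<le> 1" for r
  proof -
    have c: "path (circle r)" "path_image (circle r) \<subseteq> Y" "pathfinish (circle r) = pathstart (circle r)"
      using closed_curve_circle[OF r] by (auto simp: closed_curve_in_def Y_eq)
    then have "pathstart (circle r) \<in> Y" by auto
    then obtain u where "path u" "path_image u \<subseteq> Y" "pathstart u = x" "pathfinish u = pathstart (circle r)"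
      using path_connected_Y x unfolding path_connected_def by metis
    then show ?thesis using c by (auto simp: loops_at_def)
  qed
  define c where "c u r = (u +++ circle r +++ reversepath u) +++ linepath x x" for u r
  have c: "c u r \<in> loops_at Y x" "winding (c u r) = 1"
    if "0 < r" "r \<le> 1" "path u" "path_image u \<subseteq> Y" "pathstart u = x" "circle r \<in> loops_at Y (pathfinish u)"
    for u r
  proof -
    have l: "u +++ circle r +++ reversepath u \<in> loops_at Y x"
      using that by (auto simp: loops_at_def path_image_join)
    then show "c u r \<in> loops_at Y x"
      unfolding c_def by (intro join_in_loops_at[OF l] linepath_in_loops_at x)
    have "winding (c u r) = winding (u +++ circle r +++ reversepath u) + winding (linepath x x)"
      unfolding c_def using l linepath_in_loops_at[OF x]
      by (intro winding_join) (simp_all add: loops_at_def)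
    then show "winding (c u r) = 1" using that by (simp add: winding_conjugate winding_circle)
  qed
  obtain u1 where u1: "path u1" "path_image u1 \<subseteq> Y" "pathstart u1 = x" "circle 1 \<in> loops_at Y (pathfinish u1)"
    using conj[of 1] by auto
  have c1: "c u1 1 \<in> loops_at Y x" "winding (c u1 1) = 1" using c[of 1 u1] u1 by auto
  \<comment> \<open>The trailing constant path in \<open>c\<close> makes it literally a one-factor \<open>conj_product\<close>.\<close>
  have "path_class Y (c u1 1) \<in> spanier_subgroup Y x \<U>" if cov: "open_covering Y \<U>" for \<U>
  proof -
    obtain U where U: "U \<in> \<U>" "0 \<in> U" "openin (top_of_set Y) U"
      using cov origin_in unfolding open_covering_def by (metis UnionE)
    then obtain r where r: "0 < r" "r \<le> 1" "closed_curve_in U (circle r)"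
      using small_circle_near_origin[OF openin_imp_nbhd_in] by metis
    obtain u where u: "path u" "path_image u \<subseteq> Y" "pathstart u = x" "circle r \<in> loops_at Y (pathfinish u)"
      "pathfinish u = pathstart (circle r)" using conj[OF r(1,2)] by blast
    have cu: "c u r \<in> loops_at Y x" "winding (c u r) = 1" using c[OF r(1,2) u(1-4)] by auto
    have "homotopic_paths Y (c u1 1) (c u r)"
      using c1 cu by (intro winding_eq_imp_homotopic_paths) (auto simp: loops_at_def)
    then have "path_class Y (c u1 1) = path_class Y (conj_product x [(u, circle r)])"
      by (simp add: path_class_eq c_def del: linepath_refl)
    moreover have "circle r \<in> loops_at U (pathfinish u)"
      using r(3) u(5) by (simp add: closed_curve_in_def loops_at_def)
    then have "set [(u, circle r)] \<subseteq> {(u, v). path u \<and> path_image u \<subseteq> Y \<and> pathstart u = x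
        \<and> (\<exists>U\<in>\<U>. v \<in> loops_at U (pathfinish u))}"
      using u U(1) by auto
    ultimately show ?thesis
      unfolding spanier_subgroup_def conj_product_classes_def by blast
  qed
  then have "path_class Y (c u1 1) \<in> unbased_spanier_group Y x"
    unfolding unbased_spanier_group_def by blast
  moreover have "path_class Y (c u1 1) \<noteq> \<one>\<^bsub>fund_group Y x\<^esub>"
    using path_class_eq_one_iff[OF c1(1)] c1(2) by simp
  ultimately show ?thesis by blast
qed

section \<open>Changing a path piece by piece\<close>

text \<open>The condition on \<open>q\<close> is pointwise and not a homotopy on the piece, so that it survives concatenation:
  the straight-line homotopy between the collapsed paths can be used on all pieces at once.\<close>

definition rigid_piece :: "(real \<Rightarrow> real^3) \<Rightarrow> real \<Rightarrow> real \<Rightarrow> (real^3) set \<Rightarrow> bool" where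
  "rigid_piece w a b V \<longleftrightarrow> a < b \<and> openin (top_of_set Y) V \<and> w ` {a..b} \<subseteq> V \<and>
     (\<forall>q. continuous_on {a..b} q \<and> q ` {a..b} \<subseteq> V \<and> q a = w a \<and> q b = w b \<longrightarrow>
        (\<forall>s\<in>{a..b}. 0 \<notin> closed_segment (collapse (w s)) (collapse (q s))))"

definition rigid_partition :: "(real \<Rightarrow> real^3) \<Rightarrow> real \<Rightarrow> real \<Rightarrow> bool" where
  "rigid_partition w a b \<longleftrightarrow> (\<exists>(k::nat) t U. t 0 = a \<and> t k = b \<and>
     (\<forall>i\<in>{1..k}. rigid_piece w (t (i - 1)) (t i) (U i)))"

lemma rigid_partition_refl: "rigid_partition w a a"
  unfolding rigid_partition_def by (intro exI[of _ 0] exI[of _ "\<lambda>_. a"]) simp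

lemma rigid_partition_single: "rigid_piece w a b V \<Longrightarrow> rigid_partition w a b"
  unfolding rigid_partition_def
  by (intro exI[of _ 1] exI[of _ "\<lambda>i. if i = 0 then a else b"] exI[of _ "\<lambda>_. V"]) simp

lemma rigid_partition_trans:
  assumes "rigid_partition w a b" "rigid_partition w b c"
  shows "rigid_partition w a c"
proof -
  obtain k :: nat and t U where 1: "t 0 = a" "t k = b" "\<forall>i\<in>{1..k}. rigid_piece w (t (i - 1)) (t i) (U i)"
    using assms(1) unfolding rigid_partition_def by blast
  obtain l :: nat and t' U' where 2: "t' 0 = b" "t' l = c" "\<forall>i\<in>{1..l}. rigid_piece w (t' (i - 1)) (t' i) (U' i)"
    using assms(2) unfolding rigid_partition_def by blast
  define T where "T i = (if i \<le> k then t i else t' (i - k))" for i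
  define V where "V i = (if i \<le> k then U i else U' (i - k))" for i
  have "rigid_piece w (T (i - 1)) (T i) (V i)" if i: "i \<in> {1..k + l}" for i
  proof (cases "i \<le> k")
    case True
    then have "i - 1 \<le> k" by simp
    then show ?thesis using True 1(3) i by (simp add: T_def V_def)
  next
    case False
    then have "i - k \<in> {1..l}" using i by auto
    moreover have "T (i - 1) = t' (i - k - 1)"
    proof (cases "i - 1 \<le> k")
      case True
      then have "i = Suc k" using False by simp
      then show ?thesis using 1(2) 2(1) by (simp add: T_def)
    qed (simp add: T_def)
    ultimately show ?thesis using 2(3)[rule_format, of "i - k"] False by (simp add: T_def V_def)
  qed
  moreover have "T 0 = a" "T (k + l) = c" using 1 2 by (auto simp: T_def)
  ultimately show ?thesis unfolding rigid_partition_def by blast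
qed

text \<open>The neighbourhoods given by \<open>collapse_near_point\<close> constrain only those paths that pass through
  their centre. So the pieces near \<open>x\<close> are cut at \<open>x\<close>, and each of them has \<open>x\<close> as an end.\<close>

lemma rigid_piece_at_end:
  assumes w: "path w" "path_image w \<subseteq> Y" and x: "x \<in> {0..1}"
  obtains d where "0 < d" "\<forall>a b. 0 \<le> a \<longrightarrow> a < b \<longrightarrow> b \<le> 1 \<longrightarrow> b - a < d \<longrightarrow> a = x \<or> b = x \<longrightarrow>
      (\<exists>V. rigid_piece w a b V)"
proof -
  have wY: "w t \<in> Y" if "t \<in> {0..1}" for t using that w(2) by (auto simp: path_image_def)
  have cont: "continuous_on {0..1} w" using w(1) by (simp add: path_def)
  obtain e where e: "0 < e"
    "\<forall>(a::real) b q. continuous_on {a..b} q \<longrightarrow> q ` {a..b} \<subseteq> Y \<inter> ball (w x) e \<longrightarrow> w x \<in> q ` {a..b}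
        \<longrightarrow> (collapse \<circ> q) ` {a..b} \<subseteq> ball (collapse (w x)) (cmod (collapse (w x)))"
    by (rule collapse_near_point[OF wY[OF x]])
  define V where "V = Y \<inter> ball (w x) e"
  define D where "D = ball (collapse (w x)) (cmod (collapse (w x)))"
  have D: "0 \<notin> closed_segment y z" if "y \<in> D" "z \<in> D" for y z
  proof -
    have "closed_segment y z \<subseteq> D" using that unfolding D_def by (intro closed_segment_subset convex_ball)
    moreover have "0 \<notin> D" by (simp add: D_def)
    ultimately show ?thesis by blast
  qed
  obtain d where d: "0 < d" "\<forall>t\<in>{0..1}. dist t x < d \<longrightarrow> dist (w t) (w x) < e"
    using cont x e(1) unfolding continuous_on_iff by metis
  have "rigid_piece w a b V" if ab: "0 \<le> a" "a < b" "b \<le> 1" "b - a < d" "a = x \<or> b = x" for a b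
    unfolding rigid_piece_def
  proof (intro conjI allI impI ballI)
    show "openin (top_of_set Y) V" by (simp add: V_def openin_open_Int)
    show wV: "w ` {a..b} \<subseteq> V"
    proof (rule image_subsetI)
      fix t assume "t \<in> {a..b}"
      then have "t \<in> {0..1}" "dist t x < d" using ab by (auto simp: dist_real_def)
      then show "w t \<in> V" using wY d(2) by (simp add: V_def dist_commute)
    qed
    fix q s assume q: "continuous_on {a..b} q \<and> q ` {a..b} \<subseteq> V \<and> q a = w a \<and> q b = w b"
      and s: "s \<in> {a..b}"
    have "q x = w x" "x \<in> {a..b}" using q ab by auto
    then have "w x \<in> q ` {a..b}" "w x \<in> w ` {a..b}" by (metis imageI)+
    moreover have "continuous_on {a..b} w" using ab by (intro continuous_on_subset[OF cont]) auto
    ultimately have "(collapse \<circ> q) ` {a..b} \<subseteq> D" "(collapse \<circ> w) ` {a..b} \<subseteq> D"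
      using e(2) q wV unfolding V_def D_def by blast+
    then show "0 \<notin> closed_segment (collapse (w s)) (collapse (q s))"
      using s by (intro D) auto
  qed (use ab in auto)
  then show ?thesis using d(1) that[of d] by blast
qed

text \<open>The good radius of \<open>collapse_near_point\<close> tends to \<open>0\<close> near the gate, so a Lebesgue number argument
  with a uniform mesh is not enough. Bisection works, because near each time \<open>x\<close> an interval can be
  cut at \<open>x\<close> itself.\<close>

lemma rigid_partition_exists:
  assumes w: "path w" "path_image w \<subseteq> Y"
  shows "rigid_partition w 0 1"
proof -
  have "0 \<le> (0::real) \<and> (1::real) \<le> 1 \<longrightarrow> rigid_partition w 0 1"
  proof (rule Bolzano[of 0 1 "\<lambda>a b. 0 \<le> a \<and> b \<le> 1 \<longrightarrow> rigid_partition w a b"])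
    fix x :: real assume x: "0 \<le> x" "x \<le> 1"
    obtain d where d: "0 < d" "\<forall>a b. 0 \<le> a \<longrightarrow> a < b \<longrightarrow> b \<le> 1 \<longrightarrow> b - a < d \<longrightarrow> a = x \<or> b = x \<longrightarrow>
      (\<exists>V. rigid_piece w a b V)"
      using rigid_piece_at_end[OF w, of x] x by auto
    have "rigid_partition w a b" if ab: "0 \<le> a" "a \<le> x" "x \<le> b" "b \<le> 1" "b - a < d" for a b
    proof (rule rigid_partition_trans)
      show "rigid_partition w a x"
      proof (cases "a = x")
        case False
        then have "\<exists>V. rigid_piece w a x V" using ab d(2)[rule_format, of a x] by auto
        then show ?thesis using rigid_partition_single by blast
      qed (simp add: rigid_partition_refl)
      show "rigid_partition w x b"
      proof (cases "b = x")
        case False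
        then have "\<exists>V. rigid_piece w x b V" using ab d(2)[rule_format, of x b] by auto
        then show ?thesis using rigid_partition_single by blast
      qed (simp add: rigid_partition_refl)
    qed
    then show "\<exists>d>0. \<forall>a b. a \<le> x \<and> x \<le> b \<and> b - a < d \<longrightarrow> 0 \<le> a \<and> b \<le> 1 \<longrightarrow> rigid_partition w a b"
      using d(1) by blast
  qed (auto intro: rigid_partition_trans)
  then show ?thesis by simp
qed

text \<open>For a rigid partition of \<open>w\<close>, every modified path is homotopic to \<open>w\<close> itself, so none of them is
  homotopic to \<open>v\<close>.\<close>

lemma homotopically_path_Hausdorff_Y: "homotopically_path_Hausdorff Y"
  unfolding homotopically_path_Hausdorff_def
proof (intro allI impI, elim conjE)
  fix w v :: "real \<Rightarrow> real^3"
  assume w: "path w" "path_image w \<subseteq> Y" and nh: "\<not> homotopic_paths Y w v"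
  obtain k :: nat and t U where t: "t 0 = 0" "t k = 1"
    and rigid: "\<forall>i\<in>{1..k}. rigid_piece w (t (i - 1)) (t i) (U i)"
    using rigid_partition_exists[OF w] unfolding rigid_partition_def by blast
  have mono: "\<forall>i\<in>{1..k}. t (i - 1) < t i" using rigid by (simp add: rigid_piece_def)
  have UY: "U i \<subseteq> Y" if "i \<in> {1..k}" for i
    using rigid that openin_imp_subset unfolding rigid_piece_def by blast
  have cover: "\<exists>i\<in>{1..k}. s \<in> {t (i - 1)..t i}" if s: "s \<in> {0..1}" for s
  proof -
    define i where "i = (LEAST i. s \<le> t i)"
    have i: "s \<le> t i" "i \<le> k"
      using LeastI[of "\<lambda>i. s \<le> t i" k] Least_le[of "\<lambda>i. s \<le> t i" k] s t by (auto simp: i_def)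
    show ?thesis
    proof (cases "i = 0")
      case True
      moreover have "k \<noteq> 0" using t by (metis zero_neq_one)
      moreover have "t 0 < t 1" using mono[rule_format, of 1] \<open>k \<noteq> 0\<close> by simp
      ultimately show ?thesis using i t s by (intro bexI[of _ 1]) auto
    next
      case False
      then have "t (i - 1) < s" using not_less_Least[of "i - 1" "\<lambda>i. s \<le> t i"] by (simp add: i_def)
      then show ?thesis using i False by (intro bexI[of _ i]) auto
    qed
  qed
  have sub: "{t (i - 1)..t i} \<subseteq> {0..1}" if i: "i \<in> {1..k}" for i
  proof -
    have le: "t a \<le> t b" if "a \<le> b" "b \<le> k" for a b
      using that
    proof (induction b)
      case (Suc b)
      have "t b < t (Suc b)" using mono[rule_format, of "Suc b"] Suc.prems by simp
      then show ?case using Suc by (cases "a = Suc b") auto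
    qed simp
    show ?thesis using le[of 0 "i - 1"] le[of i k] i t by auto
  qed
  show "\<exists>(k::nat) (t::nat \<Rightarrow> real) U.
           t 0 = 0 \<and> t k = 1 \<and> (\<forall>i\<in>{1..k}. t (i - 1) < t i) \<and>
           (\<forall>i\<in>{1..k}. openin (top_of_set Y) (U i) \<and> w ` {t (i - 1)..t i} \<subseteq> U i) \<and>
           (\<forall>w'. (\<forall>i\<in>{1..k}. continuous_on {t (i - 1)..t i} (w' i) \<and>
                    w' i ` {t (i - 1)..t i} \<subseteq> U i \<and>
                    w' i (t (i - 1)) = w (t (i - 1)) \<and> w' i (t i) = w (t i)) \<longrightarrow>
                 \<not> homotopic_paths Y (concat_pieces t w') v)"
  proof (intro exI[of _ k] exI[of _ t] exI[of _ U] conjI allI impI)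
    fix w'
    assume w': "\<forall>i\<in>{1..k}. continuous_on {t (i - 1)..t i} (w' i) \<and> w' i ` {t (i - 1)..t i} \<subseteq> U i \<and>
        w' i (t (i - 1)) = w (t (i - 1)) \<and> w' i (t i) = w (t i)"
    define W where "W = concat_pieces t w'"
    have W: "W s = w' i s" if "i \<in> {1..k}" "s \<in> {t (i - 1)..t i}" for i s
      unfolding W_def using w' by (intro concat_pieces_eq[OF mono _ that]) auto
    have "continuous_on (\<Union>i\<in>{1..k}. {t (i - 1)..t i}) W"
    proof (rule continuous_on_closed_Union)
      fix i assume i: "i \<in> {1..k}"
      have "continuous_on {t (i - 1)..t i} W \<longleftrightarrow> continuous_on {t (i - 1)..t i} (w' i)"
        using W[OF i] by (intro continuous_on_cong) auto
      then show "continuous_on {t (i - 1)..t i} W" using w' i by blast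
    qed auto
    moreover have "(\<Union>i\<in>{1..k}. {t (i - 1)..t i}) = {0..1}"
      using cover sub by blast
    ultimately have pathW: "path W" by (simp add: path_def)
    have "W s \<in> Y" if s: "s \<in> {0..1}" for s
    proof -
      obtain i where i: "i \<in> {1..k}" "s \<in> {t (i - 1)..t i}" using cover[OF s] by blast
      then have "w' i s \<in> U i" using w' by blast
      then show ?thesis using UY[OF i(1)] W[OF i] by auto
    qed
    then have WY: "path_image W \<subseteq> Y" by (auto simp: path_image_def)
    have "k \<noteq> 0" using t by (metis zero_neq_one)
    then have ends: "pathstart W = pathstart w" "pathfinish W = pathfinish w"
      using W[of 1 0] W[of k 1] w'[rule_format, of 1] w'[rule_format, of k] mono[rule_format, of 1]
        mono[rule_format, of k] t
      by (auto simp: pathstart_def pathfinish_def)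
    have "homotopic_paths (- {0}) (collapse \<circ> w) (collapse \<circ> W)"
    proof (rule homotopic_paths_linear)
      fix s :: real assume "s \<in> {0..1}"
      then obtain i where i: "i \<in> {1..k}" "s \<in> {t (i - 1)..t i}" using cover by blast
      have "0 \<notin> closed_segment (collapse (w s)) (collapse (w' i s))"
        using rigid w' i unfolding rigid_piece_def by blast
      then show "closed_segment ((collapse \<circ> w) s) ((collapse \<circ> W) s) \<subseteq> - {0}"
        using W[OF i] by auto
    qed (use w pathW WY ends in \<open>auto simp: pathstart_compose pathfinish_compose intro: path_collapse\<close>)
    then have "winding w = winding W"
      unfolding winding_def by (rule winding_number_homotopic_paths)
    then have "homotopic_paths Y w W"
      using w pathW WY ends by (intro winding_eq_imp_homotopic_paths)
    then show "\<not> homotopic_paths Y (concat_pieces t w') v"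
      using nh homotopic_paths_trans unfolding W_def by blast
  qed (use t rigid in \<open>auto simp: rigid_piece_def\<close>)
qed

end

theorem proposition3p1:
  fixes C Y :: "(real^3) set"
  assumes C: "connecting_arc C"
    and Y: "Y = space_Y C"
  shows "(\<forall>x0\<in>Y. unbased_spanier_group Y x0 \<noteq> {\<one>\<^bsub>fund_group Y x0\<^esub>})
    \<and> (\<forall>x0\<in>Y. based_spanier_group Y x0 = {\<one>\<^bsub>fund_group Y x0\<^esub>})
    \<and> based_semilocally_simply_connected Y
    \<and> \<not> unbased_semilocally_simply_connected Y
    \<and> homotopically_Hausdorff Y
    \<and> \<not> strongly_homotopically_Hausdorff Y
    \<and> homotopically_path_Hausdorff Y"
proof -
  obtain g where g: "arc g" "path_image g = C" "pathstart g \<in> central_axis"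
    "pathfinish g \<in> surface_portion"
    "C \<inter> (surface_portion \<union> central_axis) = {pathstart g, pathfinish g}"
    using C unfolding connecting_arc_def by blast
  interpret surface_axis_arc g
    by unfold_locales (use g in auto)
  have "Y = space_Y (path_image g)" using Y g(2) by simp
  then show ?thesis
    using unbased_spanier_group_nontrivial based_spanier_group_trivial
      based_semilocally_simply_connected_Y not_unbased_semilocally_simply_connected_Y
      homotopically_Hausdorff_Y not_strongly_homotopically_Hausdorff_Y
      homotopically_path_Hausdorff_Y
    by simp
qed

end
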